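(* Let $f:\mathbb{R}_+\to\mathbb{C}$ be Lipschitz with $f(0)=0$. Suppose that $A,B\in\mathcal{S}_2$. Then $$\|f_s(A)-f_s(B)\|_{\mathcal{S}_2}\le \|f\|_{\mathrm{Lip}-\mathbb{C}}\,\|A-B\|_{\mathcal{S}_2},$$ and this estimate is optimal. In other words, $\|f_s\|_{\mathrm{Lip}}=\|f\|_{\mathrm{Lip}-\mathbb{C}}$.
   Context: Here $\mathbb{R}_+=[0,\infty)$ and $\mathbb{T}=\{c\in\mathbb{C}:|c|=1\}$. $\mathcal{H}$ is a separable complex Hilbert space of dimension $d$, $1\le d\le\infty$. $\mathcal{S}_2$ is the class of Hilbert-Schmidt operators on $\mathcal{H}$, i.e. compact operators $A:\mathcal{H}\to\mathcal{H}$ with singular values $s_n(A)$ satisfying $\|A\|_{\mathcal{S}_2}^2=\sum_n s_n(A)^2<\infty$. Singular value functional calculus: a compact operator $A:\mathcal{H}\to\mathcal{H}$ has a singular value decomposition $A=\sum_n s_n(A)\,u_n\otimes v_n$, meaning $Ah=\sum_n s_n(A)\langle h,v_n\rangle u_n$, with $(u_n)$ and $(v_n)$ orthonormal systems. For $f:\mathbb{R}_+\to\mathbb{C}$ continuous with $f(0)=0$ one defines $f_s(A)=\sum_n f(s_n(A))\,u_n\otimes v_n$; this is independent of the choice of singular value decomposition. Set $$\|f_s\|_{\mathrm{Lip}}=\sup_{A,B\in\mathcal{S}_2,\,A\neq B}\frac{\|f_s(A)-f_s(B)\|_{\mathcal{S}_2}}{\|A-B\|_{\mathcal{S}_2}},\qquad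 \|f\|_{\mathrm{Lip}-\mathbb{C}}=\sup_{x,y\in\mathbb{R}_+,\ c\in\mathbb{T},\ x\ne cy}\frac{|f(x)-cf(y)|}{|x-cy|}.$$ *)

theory Defs
  imports "HOL-Analysis.Analysis"
begin

section \<open>Complex Hilbert spaces\<close>

text \<open>
  The real structure (\<^const>\<open>scaleR\<close>, \<^const>\<open>inner\<close>, norm, topology) is the one underlying the complex
  structure.  The complex inner product is linear in its first argument.  Positive definiteness
  and the relation to the norm are inherited from \<^class>\<open>real_inner\<close> through \<open>inner_eq_Re_cinner\<close>.
\<close>

class complex_hilbert_space = real_inner + complete_space +
  fixes scaleC :: "complex \<Rightarrow> 'a \<Rightarrow> 'a" (infixr "*\<^sub>C" 75)
    and cinner :: "'a \<Rightarrow> 'a \<Rightarrow> complex"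
  assumes scaleC_add_right: "c *\<^sub>C (x + y) = c *\<^sub>C x + c *\<^sub>C y"
    and scaleC_add_left: "(c + d) *\<^sub>C x = c *\<^sub>C x + d *\<^sub>C x"
    and scaleC_scaleC: "c *\<^sub>C d *\<^sub>C x = (c * d) *\<^sub>C x"
    and scaleC_of_real: "complex_of_real r *\<^sub>C x = r *\<^sub>R x"
    and cinner_add_left: "cinner (x + y) z = cinner x z + cinner y z"
    and cinner_scaleC_left: "cinner (c *\<^sub>C x) y = c * cinner x y"
    and cinner_commute: "cinner x y = cnj (cinner y x)"
    and inner_eq_Re_cinner: "inner x y = Re (cinner x y)"

instantiation complex :: complex_hilbert_space
begin

definition scaleC_complex :: "complex \<Rightarrow> complex \<Rightarrow> complex"
  where "scaleC_complex c x = c * x"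

definition cinner_complex :: "complex \<Rightarrow> complex \<Rightarrow> complex"
  where "cinner_complex x y = x * cnj y"

instance
  by standard
    (auto simp: scaleC_complex_def cinner_complex_def algebra_simps scaleR_conv_of_real
      inner_complex_def)

end

lemma vector_space_scaleC: "vector_space (scaleC :: complex \<Rightarrow> 'a::complex_hilbert_space \<Rightarrow> 'a)"
  using scaleC_of_real[of 1, where ?'a = 'a]
  by unfold_locales (simp_all add: scaleC_add_right scaleC_add_left scaleC_scaleC)

section \<open>Singular values and Hilbert-Schmidt operators\<close>

definition compact_operator :: "('a::complex_hilbert_space \<Rightarrow> 'a) \<Rightarrow> bool"
  where "compact_operator A \<longleftrightarrow>
    Vector_Spaces.linear (*\<^sub>C) (*\<^sub>C) A \<and> compact (closure (A ` cball 0 1))"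

definition orthonormal_on :: "nat set \<Rightarrow> (nat \<Rightarrow> 'a::complex_hilbert_space) \<Rightarrow> bool"
  where "orthonormal_on N u \<longleftrightarrow> (\<forall>m\<in>N. \<forall>n\<in>N. cinner (u m) (u n) = (if m = n then 1 else 0))"

text \<open>
  \<open>A = \<Sum>n. s n u\<^sub>n \<otimes> v\<^sub>n\<close> with \<open>s\<close> nonincreasing and tending to \<open>0\<close> (hence nonnegative).
  The vectors \<open>u n\<close> and \<open>v n\<close> are constrained only where \<open>s n > 0\<close>, so that operators of
  finite rank and finite-dimensional spaces, where \<open>s\<close> is padded with zeros, are covered.
\<close>

definition is_svd ::
    "('a::complex_hilbert_space \<Rightarrow> 'a) \<Rightarrow> (nat \<Rightarrow> real) \<Rightarrow> (nat \<Rightarrow> 'a) \<Rightarrow> (nat \<Rightarrow> 'a) \<Rightarrow> bool"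
  where "is_svd A s u v \<longleftrightarrow>
    decseq s \<and> s \<longlonglongrightarrow> 0 \<and>
    orthonormal_on {n. s n > 0} u \<and> orthonormal_on {n. s n > 0} v \<and>
    (\<forall>h. (\<lambda>n. (complex_of_real (s n) * cinner h (v n)) *\<^sub>C u n) sums A h)"

definition singular_value :: "('a::complex_hilbert_space \<Rightarrow> 'a) \<Rightarrow> nat \<Rightarrow> real"
  where "singular_value A = (THE s. \<exists>u v. is_svd A s u v)"

definition hilbert_schmidt :: "('a::complex_hilbert_space \<Rightarrow> 'a) set"
  where "hilbert_schmidt =
    {A. compact_operator A \<and> summable (\<lambda>n. (singular_value A n)\<^sup>2)}"

definition hs_norm :: "('a::complex_hilbert_space \<Rightarrow> 'a) \<Rightarrow> real"
  where "hs_norm A = sqrt (\<Sum>n. (singular_value A n)\<^sup>2)"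

text \<open>
  The singular value functional calculus.  It is meant for compact \<open>A\<close> and for \<open>f\<close> continuous on
  \<open>[0, \<infinity>)\<close> with \<open>f 0 = 0\<close>; the result then does not depend on the decomposition chosen.
\<close>

definition sv_calculus ::
    "(real \<Rightarrow> complex) \<Rightarrow> ('a::complex_hilbert_space \<Rightarrow> 'a) \<Rightarrow> 'a \<Rightarrow> 'a"
  where "sv_calculus f A =
    (let (u, v) = (SOME (u, v). is_svd A (singular_value A) u v)
     in (\<lambda>h. \<Sum>n. (f (singular_value A n) * cinner h (v n)) *\<^sub>C u n))"

section \<open>Lipschitz seminorms\<close>

text \<open>
  Both suprema are taken in \<open>[0, \<infinity>]\<close>.  The underlying Hilbert space is passed as a type argument.
  Only the values of \<open>f\<close> on \<open>[0, \<infinity>)\<close> matter.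
\<close>

definition sv_Lip_norm :: "'a::complex_hilbert_space itself \<Rightarrow> (real \<Rightarrow> complex) \<Rightarrow> ennreal"
  where "sv_Lip_norm _ f =
    (SUP (A, B) \<in> {(A, B). A \<in> hilbert_schmidt \<and> B \<in> hilbert_schmidt \<and> A \<noteq> B}.
      ennreal (hs_norm (\<lambda>h::'a. sv_calculus f A h - sv_calculus f B h) / hs_norm (\<lambda>h. A h - B h)))"

definition Lip_C_norm :: "(real \<Rightarrow> complex) \<Rightarrow> ennreal"
  where "Lip_C_norm f =
    (SUP (x, y, c) \<in> {(x, y, c). 0 \<le> x \<and> 0 \<le> y \<and> cmod c = 1 \<and>
        complex_of_real x \<noteq> c * complex_of_real y}.
      ennreal (cmod (f x - c * f y) / cmod (complex_of_real x - c * complex_of_real y)))"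

end

theory Submission
  imports Defs
begin

text \<open>
  For unit \<open>c\<close> aligned with the cross term, the condition defining \<open>L = Lip_C_norm f\<close> says exactly that
  \<open>2 |L\<^sup>2 x y - f x cnj (f y)| \<le> g x + g y\<close> with \<open>g x = L\<^sup>2 x\<^sup>2 - |f x|\<^sup>2 \<ge> 0\<close>.
  Expanding both Hilbert-Schmidt norms along singular value decompositions \<open>(s, u, v)\<close> of \<open>A\<close> and
  \<open>(t, x, y)\<close> of \<open>B\<close>, the difference \<open>L\<^sup>2 \<parallel>A - B\<parallel>\<^sup>2 - \<parallel>f\<^sub>s(A) - f\<^sub>s(B)\<parallel>\<^sup>2\<close> equals
  \<open>\<Sum>g(s\<^sub>n) + \<Sum>g(t\<^sub>m) - 2 Re \<Sum>(L\<^sup>2 s\<^sub>n t\<^sub>m - f(s\<^sub>n) cnj (f(t\<^sub>m))) a\<^sub>n\<^sub>m\<close>, where the matrix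
  \<open>a\<^sub>n\<^sub>m = \<langle>u\<^sub>n, x\<^sub>m\<rangle> \<langle>y\<^sub>m, v\<^sub>n\<rangle>\<close> has absolute row and column sums at most \<open>1\<close> by Bessel's
  inequality; hence it is nonnegative.  To avoid orthonormal bases, the Hilbert-Schmidt norm is
  treated as a supremum of \<open>\<Sum>\<parallel>A e\<parallel>\<^sup>2\<close> over finite orthonormal sets, and the computation is done on
  truncations.  Rank one operators \<open>x e \<otimes> e\<close> and \<open>c y e \<otimes> e\<close> show optimality.
\<close>

section \<open>Complex inner products and orthonormal families\<close>

lemma cinner_zero_left [simp]: "cinner 0 (y::'a::complex_hilbert_space) = 0"
  using cinner_add_left[of 0 0 y] by simp

lemma cinner_zero_right [simp]: "cinner (y::'a::complex_hilbert_space) 0 = 0"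
  using cinner_commute[of y 0] by simp

lemma cinner_add_right: "cinner (z::'a::complex_hilbert_space) (x + y) = cinner z x + cinner z y"
  by (metis cinner_add_left cinner_commute complex_cnj_add)

lemma cinner_scaleC_right: "cinner (x::'a::complex_hilbert_space) (c *\<^sub>C y) = cnj c * cinner x y"
  by (metis cinner_scaleC_left cinner_commute complex_cnj_mult)

lemma scaleC_minus_one: "(- 1) *\<^sub>C x = - (x::'a::complex_hilbert_space)"
  using scaleC_of_real[of "-1" x] by simp

lemma scaleC_one [simp]: "1 *\<^sub>C x = (x::'a::complex_hilbert_space)"
  using scaleC_of_real[of 1 x] by simp

lemma scaleC_zero_left [simp]: "0 *\<^sub>C x = (0::'a::complex_hilbert_space)"
  using scaleC_of_real[of 0 x] by simp

lemma scaleC_zero_right [simp]: "c *\<^sub>C (0::'a::complex_hilbert_space) = 0"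
  using scaleC_add_right[of c "0::'a" 0] by simp

lemma cinner_minus_left: "cinner (- x) (y::'a::complex_hilbert_space) = - cinner x y"
  using cinner_scaleC_left[of "-1" x y] by (simp add: scaleC_minus_one)

lemma cinner_diff_left: "cinner (x - z) (y::'a::complex_hilbert_space) = cinner x y - cinner z y"
  using cinner_add_left[of x "- z" y] by (simp add: cinner_minus_left)

lemma scaleC_minus_right: "c *\<^sub>C (- x) = - (c *\<^sub>C (x::'a::complex_hilbert_space))"
  by (metis add.right_inverse eq_neg_iff_add_eq_0 scaleC_add_right scaleC_zero_right add.commute)

lemma scaleC_diff_right: "c *\<^sub>C (x - y) = c *\<^sub>C x - c *\<^sub>C (y::'a::complex_hilbert_space)"
  using scaleC_add_right[of c x "- y"] by (simp add: scaleC_minus_right)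

lemma scaleC_diff_left: "(c - d) *\<^sub>C x = c *\<^sub>C x - d *\<^sub>C (x::'a::complex_hilbert_space)"
  by (metis diff_add_cancel add_diff_cancel scaleC_add_left)

lemma cinner_sum_left: "cinner (\<Sum>i\<in>S. x i) (y::'a::complex_hilbert_space) = (\<Sum>i\<in>S. cinner (x i) y)"
  by (induction S rule: infinite_finite_induct) (auto simp: cinner_add_left)

lemma cinner_sum_right: "cinner (y::'a::complex_hilbert_space) (\<Sum>i\<in>S. x i) = (\<Sum>i\<in>S. cinner y (x i))"
  by (induction S rule: infinite_finite_induct) (auto simp: cinner_add_right)

lemma cinner_self: "cinner x x = complex_of_real ((norm (x::'a::complex_hilbert_space))\<^sup>2)"
proof -
  have "Im (cinner x x) = 0"
    using cinner_commute[of x x] by (metis cnj.simps(2) equal_neg_zero)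
  then show ?thesis
    by (simp add: complex_eq_iff flip: inner_eq_Re_cinner dot_square_norm)
qed

lemma norm_scaleC: "norm (c *\<^sub>C x) = cmod c * norm (x::'a::complex_hilbert_space)"
proof -
  have "complex_of_real ((norm (c *\<^sub>C x))\<^sup>2) = (c * cnj c) * complex_of_real ((norm x)\<^sup>2)"
    by (metis cinner_self cinner_scaleC_left cinner_scaleC_right mult.assoc)
  also have "\<dots> = complex_of_real ((cmod c * norm x)\<^sup>2)"
    by (simp only: power_mult_distrib of_real_mult complex_norm_square)
  finally have "(norm (c *\<^sub>C x))\<^sup>2 = (cmod c * norm x)\<^sup>2"
    by (simp only: of_real_eq_iff)
  then show ?thesis by simp
qed

lemma norm_diff_sq:
  "(norm (x - y))\<^sup>2 = (norm x)\<^sup>2 + (norm y)\<^sup>2 - 2 * Re (cinner x (y::'a::complex_hilbert_space))"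
  by (simp add: power2_norm_eq_inner inner_diff algebra_simps inner_commute flip: inner_eq_Re_cinner)

lemma norm_add_sq:
  "(norm (x + y))\<^sup>2 = (norm x)\<^sup>2 + (norm y)\<^sup>2 + 2 * Re (cinner x (y::'a::complex_hilbert_space))"
  by (simp add: power2_norm_eq_inner inner_add algebra_simps inner_commute flip: inner_eq_Re_cinner)

text \<open>Reduces \<open>cinner\<close> to two real inner products, so that continuity of the real
  inner product carries over to it.\<close>

lemma cinner_eq_Complex:
  "cinner x y = Complex (inner x y) (inner x (\<i> *\<^sub>C (y::'a::complex_hilbert_space)))"
  by (simp add: complex_eq_iff inner_eq_Re_cinner cinner_scaleC_right)

lemma tendsto_cinner_left:
  assumes "(x \<longlongrightarrow> l) F"
  shows "((\<lambda>n. cinner (x n) (y::'a::complex_hilbert_space)) \<longlongrightarrow> cinner l y) F"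
  unfolding cinner_eq_Complex by (intro tendsto_intros assms)

lemma continuous_on_scaleC_left:
  "continuous_on S (\<lambda>c. c *\<^sub>C (x::'a::complex_hilbert_space))"
proof -
  have "dist (c *\<^sub>C x) (d *\<^sub>C x) \<le> norm x * dist c d" for c d
    by (simp add: dist_norm norm_scaleC mult.commute flip: scaleC_diff_left)
  then have "(norm x)-lipschitz_on S (\<lambda>c. c *\<^sub>C x)"
    by (intro lipschitz_onI) auto
  then show ?thesis by (rule lipschitz_on_continuous_on)
qed

section \<open>Orthonormal families, Bessel's inequality and Gram-Schmidt extension\<close>

definition orthonormal_family :: "'i set \<Rightarrow> ('i \<Rightarrow> 'a::complex_hilbert_space) \<Rightarrow> bool"
  where "orthonormal_family I u \<longleftrightarrow> (\<forall>i\<in>I. \<forall>j\<in>I. cinner (u i) (u j) = (if i = j then 1 else 0))"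

text \<open>A set of vectors is treated as a family indexed by itself; test sets for Hilbert-Schmidt
  sums and sequences of singular vectors thus share one notion of orthonormality.\<close>

abbreviation orthonormal_set :: "'a::complex_hilbert_space set \<Rightarrow> bool"
  where "orthonormal_set F \<equiv> orthonormal_family F (\<lambda>e. e)"

lemma orthonormal_on_iff_family: "orthonormal_on N u \<longleftrightarrow> orthonormal_family N u"
  by (simp add: orthonormal_on_def orthonormal_family_def)

lemma orthonormal_familyD:
  "orthonormal_family I u \<Longrightarrow> i \<in> I \<Longrightarrow> j \<in> I \<Longrightarrow> cinner (u i) (u j) = (if i = j then 1 else 0)"
  by (simp add: orthonormal_family_def)

lemma orthonormal_family_subset:
  "orthonormal_family I u \<Longrightarrow> J \<subseteq> I \<Longrightarrow> orthonormal_family J u"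
  unfolding orthonormal_family_def by blast

lemma orthonormal_family_norm: "orthonormal_family I u \<Longrightarrow> i \<in> I \<Longrightarrow> norm (u i) = 1"
  using orthonormal_familyD[of I u i i] cinner_self[of "u i"]
  by (metis norm_ge_zero of_real_eq_1_iff power2_eq_1_iff abs_of_nonneg abs_minus_cancel abs_one)

lemma orthonormal_family_inj: "orthonormal_family I u \<Longrightarrow> inj_on u I"
  by (metis inj_onI orthonormal_familyD zero_neq_one)

lemma orthonormal_family_image:
  "orthonormal_family I u \<Longrightarrow> orthonormal_set (u ` I)"
  using orthonormal_family_inj[of I u]
  by (auto simp: orthonormal_family_def inj_on_def)

text \<open>Indices outside \<open>I\<close> are allowed when their coefficient vanishes, because
  singular vectors are unconstrained where the singular value is zero.\<close>

lemma norm_sum_orthonormal: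
  assumes u: "orthonormal_family I u" and S: "finite S" "\<And>i. i \<in> S \<Longrightarrow> a i \<noteq> 0 \<Longrightarrow> i \<in> I"
  shows "(norm (\<Sum>i\<in>S. a i *\<^sub>C u i))\<^sup>2 = (\<Sum>i\<in>S. (cmod (a i))\<^sup>2)"
proof -
  have "cinner (\<Sum>i\<in>S. a i *\<^sub>C u i) (\<Sum>i\<in>S. a i *\<^sub>C u i)
      = (\<Sum>i\<in>S. \<Sum>j\<in>S. a i * (cnj (a j) * cinner (u i) (u j)))"
    by (simp add: cinner_sum_left cinner_sum_right cinner_scaleC_left cinner_scaleC_right
        sum_distrib_left mult.left_commute)
      (rule sum.swap)
  also have "\<dots> = (\<Sum>i\<in>S. \<Sum>j\<in>S. if i = j then a i * cnj (a i) else 0)"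
    using S(2) orthonormal_familyD[OF u]
    by (intro sum.cong refl) (metis mult_cancel_left complex_cnj_zero mult.right_neutral mult_zero_right mult_zero_left)
  also have "\<dots> = (\<Sum>i\<in>S. complex_of_real ((cmod (a i))\<^sup>2))"
    by (simp add: S sum.delta complex_norm_square del: of_real_power)
  finally show ?thesis
    unfolding cinner_self of_real_sum[symmetric] of_real_eq_iff .
qed

text \<open>By Pythagoras, the cross term is exactly the sum of squared coefficients. The equality
  yields both Bessel's inequality and the fact that the residual is no longer than
  \<open>h\<close>.\<close>

lemma bessel_residual:
  assumes v: "orthonormal_family S v" and S: "finite S"
  shows "(norm (h - (\<Sum>i\<in>S. cinner h (v i) *\<^sub>C v i)))\<^sup>2 = (norm h)\<^sup>2 - (\<Sum>i\<in>S. (cmod (cinner h (v i)))\<^sup>2)"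
proof -
  have "cinner h (\<Sum>i\<in>S. cinner h (v i) *\<^sub>C v i) = (\<Sum>i\<in>S. complex_of_real ((cmod (cinner h (v i)))\<^sup>2))"
    by (simp add: cinner_sum_right cinner_scaleC_right complex_norm_square mult.commute del: of_real_power)
  then have "Re (cinner h (\<Sum>i\<in>S. cinner h (v i) *\<^sub>C v i)) = (\<Sum>i\<in>S. (cmod (cinner h (v i)))\<^sup>2)"
    by simp
  then show ?thesis
    using norm_sum_orthonormal[OF v S] by (simp add: norm_diff_sq)
qed

lemma bessel:
  assumes "orthonormal_family S v" and "finite S"
  shows "(\<Sum>i\<in>S. (cmod (cinner h (v i)))\<^sup>2) \<le> (norm h)\<^sup>2"
  using bessel_residual[OF assms, of h] by (smt (verit) zero_le_power2)

lemma residual_orthogonal: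
  assumes v: "orthonormal_family S v" and S: "finite S" "j \<in> S"
  shows "cinner (h - (\<Sum>i\<in>S. cinner h (v i) *\<^sub>C v i)) (v j) = 0"
proof -
  have "(\<Sum>i\<in>S. cinner h (v i) * cinner (v i) (v j)) = (\<Sum>i\<in>S. if i = j then cinner h (v j) else 0)"
    using orthonormal_familyD[OF v] S by (intro sum.cong) auto
  then show ?thesis
    using S by (simp add: cinner_diff_left cinner_sum_left cinner_scaleC_left)
qed

lemma norm_cinner_commute: "cmod (cinner x y) = cmod (cinner y (x::'a::complex_hilbert_space))"
  by (metis cinner_commute complex_mod_cnj)

lemma orthonormal_set_insert:
  assumes "orthonormal_set F" "norm g = 1" "\<And>e. e \<in> F \<Longrightarrow> cinner g e = 0"
  shows "orthonormal_set (insert g F)"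
proof -
  have "cinner e g = 0" if "e \<in> F" for e
    using assms(3)[OF that] cinner_commute[of e g] by simp
  moreover have "g \<notin> F"
    using assms(2) assms(3)[of g] by (auto simp: cinner_self)
  ultimately show ?thesis
    using assms by (auto simp: orthonormal_family_def cinner_self)
qed

text \<open>Gram-Schmidt, one vector at a time: the normalised residual of the new vector is
  adjoined unless it vanishes. It provides a finite test set on which Parseval's identity holds for
  prescribed vectors.\<close>

lemma orthonormal_set_extend:
  assumes "finite V" "finite F" "orthonormal_set F"
  shows "\<exists>G. finite G \<and> F \<subseteq> G \<and> orthonormal_set G \<and> (\<forall>v\<in>V. v = (\<Sum>e\<in>G. cinner v e *\<^sub>C e))"
  using assms(1)
proof induction
  case empty
  then show ?case using assms by auto
next
  case (insert w V)
  then obtain G where G: "finite G" "F \<subseteq> G" "orthonormal_set G"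
    "\<And>v. v \<in> V \<Longrightarrow> v = (\<Sum>e\<in>G. cinner v e *\<^sub>C e)" by blast
  define r where "r = w - (\<Sum>e\<in>G. cinner w e *\<^sub>C e)"
  have r0: "cinner r e = 0" if "e \<in> G" for e
    unfolding r_def using residual_orthogonal[OF G(3,1) that] .
  show ?case
  proof (cases "r = 0")
    case True
    then show ?thesis using G r_def by (intro exI[of _ G]) auto
  next
    case False
    define g where "g = (1 / complex_of_real (norm r)) *\<^sub>C r"
    have g0: "cinner g e = 0" if "e \<in> G" for e
      using r0[OF that] by (simp add: g_def cinner_scaleC_left)
    have g0': "cinner e g = 0" if "e \<in> G" for e
      using g0[OF that] cinner_commute[of e g] by simp
    have ng: "norm g = 1" using False by (simp add: g_def norm_scaleC norm_divide)
    have on: "orthonormal_set (insert g G)"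
      by (rule orthonormal_set_insert[OF G(3) ng g0])
    have gG: "g \<notin> G" using g0[of g] ng by (auto simp: cinner_self)
    \<comment> \<open>The earlier vectors already lie in the span of \<open>G\<close>, hence are
      orthogonal to \<open>g\<close>, and their expansion over the larger set gains only a zero
      term.\<close>
    have "cinner v g = 0" if "v \<in> V" for v
    proof -
      have "cinner v g = (\<Sum>e\<in>G. cinner v e * cinner e g)"
        using G(4)[OF that] by (metis (no_types, lifting) cinner_scaleC_left cinner_sum_left sum.cong)
      also have "\<dots> = 0"
        using g0' by (intro sum.neutral) simp
      finally show ?thesis .
    qed
    then have 1: "v = (\<Sum>e\<in>insert g G. cinner v e *\<^sub>C e)" if "v \<in> V" for v
      using G(4)[OF that] that G(1) gG by simp
    have "cinner r g = complex_of_real (norm r)"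
      using False by (simp add: g_def cinner_scaleC_right cinner_self power2_eq_square)
    moreover have "cinner (\<Sum>e\<in>G. cinner w e *\<^sub>C e) g = 0"
      using g0' by (simp add: cinner_sum_left cinner_scaleC_left)
    ultimately have "cinner w g = complex_of_real (norm r)"
      using cinner_add_left[of r "\<Sum>e\<in>G. cinner w e *\<^sub>C e" g] by (simp add: r_def)
    then have "cinner w g *\<^sub>C g = r"
      using False by (simp add: g_def scaleC_scaleC)
    then have "w = (\<Sum>e\<in>insert g G. cinner w e *\<^sub>C e)"
      using G(1) gG by (simp add: r_def)
    with 1 show ?thesis
      using G on by (intro exI[of _ "insert g G"]) blast
  qed
qed

lemma parseval_span:
  assumes "v = (\<Sum>e\<in>G. cinner v e *\<^sub>C e)"
  shows "cinner v w = (\<Sum>e\<in>G. cinner v e * cinner e w)"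
  by (subst assms) (simp add: cinner_sum_left cinner_scaleC_left)

section \<open>Existence of singular value decompositions\<close>

abbreviation clinear :: "('a::complex_hilbert_space \<Rightarrow> 'a) \<Rightarrow> bool"
  where "clinear \<equiv> Vector_Spaces.linear (*\<^sub>C) (*\<^sub>C)"

lemma clinear_iff:
  "clinear (A :: 'a::complex_hilbert_space \<Rightarrow> 'a) \<longleftrightarrow>
    (\<forall>x y. A (x + y) = A x + A y) \<and> (\<forall>c x. A (c *\<^sub>C x) = c *\<^sub>C A x)"
  by (simp add: Vector_Spaces.linear_iff vector_space_scaleC)

context
  fixes A :: "'a::complex_hilbert_space \<Rightarrow> 'a"
  assumes A: "clinear A"
begin

lemma clinear_add: "A (x + y) = A x + A y"
  using A by (simp add: clinear_iff)

lemma clinear_scaleC: "A (c *\<^sub>C x) = c *\<^sub>C A x"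
  using A by (simp add: clinear_iff)

lemma clinear_zero [simp]: "A 0 = 0"
  using clinear_scaleC[of 0 0] by simp

lemma clinear_diff: "A (x - y) = A x - A y"
  using clinear_add[of "x - y" y] by (simp add: algebra_simps)

lemma clinear_sum: "A (\<Sum>i\<in>S. x i) = (\<Sum>i\<in>S. A (x i))"
  by (induction S rule: infinite_finite_induct) (auto simp: clinear_add)

lemma clinear_scaleR: "A (r *\<^sub>R x) = r *\<^sub>R A x"
  by (metis clinear_scaleC scaleC_of_real)

text \<open>Rescaling \<open>z\<close> to unit norm stays inside \<open>M\<close>. Closure under
  scaling suffices, so the lemma serves the whole space and orthogonal complements alike.\<close>

lemma clinear_bound_homogeneous:
  assumes M: "\<And>c w. w \<in> M \<Longrightarrow> c *\<^sub>C w \<in> M"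
    and le: "\<And>w. w \<in> M \<Longrightarrow> norm w \<le> 1 \<Longrightarrow> norm (A w) \<le> s" and z: "z \<in> M"
  shows "norm (A z) \<le> s * norm z"
proof (cases "z = 0")
  case False
  define c where "c = 1 / complex_of_real (norm z)"
  have c: "cmod c = 1 / norm z" by (simp add: c_def norm_divide)
  have "norm (A (c *\<^sub>C z)) \<le> s"
    using False c by (intro le M z) (simp add: norm_scaleC)
  then show ?thesis
    using False c by (simp add: clinear_scaleC norm_scaleC field_simps)
qed (simp add: z)

end

lemma compact_operator_bounded_linear:
  fixes A :: "'a::complex_hilbert_space \<Rightarrow> 'a"
  assumes "compact_operator A"
  shows "bounded_linear A"
proof -
  have lin: "clinear A" and cpt: "compact (closure (A ` cball 0 1))"
    using assms by (auto simp: compact_operator_def)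
  have "bounded (A ` cball 0 1)"
    using compact_imp_bounded[OF cpt] closure_subset bounded_subset by blast
  then have "\<exists>K. \<forall>y \<in> A ` cball 0 1. norm y \<le> K"
    by (simp only: bounded_iff)
  then obtain K where K: "\<And>x. x \<in> cball 0 1 \<Longrightarrow> norm (A x) \<le> K"
    by (meson imageI)
  have "norm (A z) \<le> K * norm z" for z
    by (rule clinear_bound_homogeneous[OF lin, of UNIV]) (use K in auto)
  then show ?thesis
    by (intro bounded_linear_intro[of _ K])
      (auto simp: clinear_add[OF lin] clinear_scaleR[OF lin] mult.commute)
qed

section \<open>Orthogonal complements and norm-maximising vectors\<close>

definition ortho_complement :: "'a::complex_hilbert_space set \<Rightarrow> 'a set"
  where "ortho_complement V = {w. \<forall>v\<in>V. cinner w v = 0}"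

lemma ortho_complement_scaleC: "w \<in> ortho_complement V \<Longrightarrow> c *\<^sub>C w \<in> ortho_complement V"
  by (simp add: ortho_complement_def cinner_scaleC_left)

lemma ortho_complement_add:
  "w \<in> ortho_complement V \<Longrightarrow> z \<in> ortho_complement V \<Longrightarrow> w + z \<in> ortho_complement V"
  by (simp add: ortho_complement_def cinner_add_left)

lemma ortho_complement_zero: "0 \<in> ortho_complement V"
  by (simp add: ortho_complement_def)

lemma ortho_complement_lim:
  assumes "\<And>n::nat. x n \<in> ortho_complement V" "x \<longlonglongrightarrow> l"
  shows "l \<in> ortho_complement V"
proof -
  have "cinner l v = 0" if "v \<in> V" for v
  proof -
    have "(\<lambda>n. cinner (x n) v) \<longlonglongrightarrow> cinner l v"
      by (intro tendsto_cinner_left assms)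
    moreover have "(\<lambda>n. cinner (x n) v) = (\<lambda>n. 0)"
      using assms(1) that by (simp add: ortho_complement_def)
    ultimately show ?thesis by (simp add: LIMSEQ_const_iff)
  qed
  then show ?thesis by (simp add: ortho_complement_def)
qed

text \<open>
  A maximising sequence whose images converge is itself Cauchy, by the parallelogram law.
\<close>

lemma compact_operator_maximiser:
  fixes A :: "'a::complex_hilbert_space \<Rightarrow> 'a"
  assumes "compact_operator A"
  shows "\<exists>v\<in>ortho_complement V. norm v \<le> 1 \<and>
    (\<forall>w\<in>ortho_complement V. norm w \<le> 1 \<longrightarrow> norm (A w) \<le> norm (A v))"
proof -
  define M where "M = ortho_complement V"
  have lin: "clinear A" and cpt: "compact (closure (A ` cball 0 1))"
    using assms by (auto simp: compact_operator_def)
  note bl = compact_operator_bounded_linear[OF assms]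
  obtain K where K: "\<And>x. norm (A x) \<le> K * norm x" "0 < K"
    using bounded_linear.pos_bounded[OF bl] by (auto simp: mult.commute)
  define B where "B = {w \<in> M. norm w \<le> 1}"
  define s where "s = (SUP w\<in>B. norm (A w))"
  have bdd: "bdd_above ((\<lambda>w. norm (A w)) ` B)"
  proof (rule bdd_aboveI2)
    fix w assume "w \<in> B"
    then have "K * norm w \<le> K * 1"
      using K(2) by (intro mult_left_mono) (auto simp: B_def)
    with K(1)[of w] show "norm (A w) \<le> K" by simp
  qed
  have le_s: "norm (A w) \<le> s" if "w \<in> B" for w
    unfolding s_def by (rule cSUP_upper[OF that bdd])
  have B0: "0 \<in> B" by (simp add: B_def M_def ortho_complement_zero)
  have s0: "0 \<le> s" using le_s[OF B0] by (simp add: clinear_zero[OF lin])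
  have hom: "norm (A z) \<le> s * norm z" if "z \<in> M" for z
    by (rule clinear_bound_homogeneous[OF lin, of M])
      (use le_s that in \<open>auto simp: B_def M_def ortho_complement_scaleC\<close>)
  show ?thesis
  proof (cases "s = 0")
    case True
    have "norm (A w) \<le> norm (A 0)" if "w \<in> M" "norm w \<le> 1" for w
      using le_s[of w] that by (simp add: B_def True clinear_zero[OF lin])
    with B0 show ?thesis by (intro bexI[of _ 0]) (auto simp: B_def M_def)
  next
    case False
    with s0 have s: "0 < s" by simp
    have "\<exists>w\<in>B. s - 1 / Suc n < norm (A w)" for n
      using less_cSUP_iff[OF _ bdd, of "s - 1 / Suc n"] B0 by (auto simp: s_def)
    then obtain w where w: "\<And>n. w n \<in> B" "\<And>n. s - 1 / Suc n < norm (A (w n))"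
      by metis
    have "A (w n) \<in> closure (A ` cball 0 1)" for n
      using w(1)[of n] closure_subset by (fastforce simp: B_def)
    then obtain y r where r: "strict_mono r" "((\<lambda>n. A (w n)) \<circ> r) \<longlonglongrightarrow> y"
      using compact_imp_seq_compact[OF cpt] unfolding seq_compact_def by metis
    define x where "x = w \<circ> r"
    have xB: "x n \<in> B" for n using w(1) by (simp add: x_def)
    have lim: "(\<lambda>n. A (x n)) \<longlonglongrightarrow> y" using r(2) by (simp add: x_def comp_def)
    have "(\<lambda>n. s - 1 / Suc n) \<longlonglongrightarrow> s - 0"
      by (intro tendsto_intros LIMSEQ_Suc[OF lim_1_over_n])
    then have "(\<lambda>n. s - 1 / Suc n) \<longlonglongrightarrow> s" by simp
    then have "(\<lambda>n. norm (A (w n))) \<longlonglongrightarrow> s"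
    proof (rule tendsto_sandwich[rotated 2])
      show "\<forall>\<^sub>F n in sequentially. s - 1 / Suc n \<le> norm (A (w n))"
        using w(2) by (intro always_eventually allI less_imp_le)
      show "\<forall>\<^sub>F n in sequentially. norm (A (w n)) \<le> s"
        by (intro always_eventually allI le_s w(1))
    qed simp
    then have "(\<lambda>n. norm (A (x n))) \<longlonglongrightarrow> s"
      using LIMSEQ_subseq_LIMSEQ[OF _ r(1)] by (fastforce simp: x_def comp_def)
    then have ny: "norm y = s"
      using LIMSEQ_unique tendsto_norm[OF lim] by blast
    have "Cauchy x"
    proof (rule metric_CauchyI)
      fix e :: real assume e: "0 < e"
      \<comment> \<open>The constant is chosen so that \<open>2 * s - 2 * d < s * a\<close> becomes
        \<open>2 - a < e\<^sup>2 / 4\<close> after division by \<open>s\<close>.\<close>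
      define d where "d = s * e\<^sup>2 / 8"
      have "0 < d" using s e by (simp add: d_def)
      then obtain N where N: "\<And>n. n \<ge> N \<Longrightarrow> norm (A (x n) - y) < d"
        using LIMSEQ_D[OF lim] by blast
      have "dist (x m) (x n) < e" if mn: "m \<ge> N" "n \<ge> N" for m n
      proof -
        define a where "a = norm (x m + x n)"
        have M: "x m + x n \<in> M"
          using xB unfolding B_def M_def by (auto intro: ortho_complement_add)
        \<comment> \<open>Since \<open>A (x m) + A (x n)\<close> is close to
          \<open>2 *\<^sub>R y\<close>, whose norm is \<open>2 * s\<close>, the sum
          \<open>x m + x n\<close> has norm close to 2.\<close>
        have "2 * s - norm (A (x m + x n)) \<le> norm (2 *\<^sub>R y - A (x m + x n))"
          using norm_triangle_ineq2[of "2 *\<^sub>R y" "A (x m + x n)"] by (simp add: ny)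
        also have "\<dots> = norm ((A (x m) - y) + (A (x n) - y))"
          by (subst norm_minus_commute) (simp add: clinear_add[OF lin] algebra_simps scaleR_2)
        also have "\<dots> < 2 * d"
          using norm_triangle_ineq[of "A (x m) - y" "A (x n) - y"] N[OF mn(1)] N[OF mn(2)] by linarith
        finally have "2 * s - 2 * d < s * a"
          using hom[OF M] by (simp add: a_def)
        then have "2 - a < e\<^sup>2 / 4"
          using s mult_less_cancel_left_pos[of s "2 - a" "e\<^sup>2 / 4"]
          by (simp add: d_def right_diff_distrib)
        moreover have x1: "norm (x m) \<le> 1" "norm (x n) \<le> 1" and a: "0 \<le> a"
          using xB by (auto simp: B_def a_def)
        moreover have "a \<le> 2"
          using norm_triangle_ineq[of "x m" "x n"] x1 by (simp add: a_def)
        ultimately have "4 * (2 - a) < e\<^sup>2" by auto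
        moreover have "(2 - a) * (2 + a) \<le> (2 - a) * 4"
          using \<open>a \<le> 2\<close> by (intro mult_left_mono) auto
        moreover have "(norm (x m - x n))\<^sup>2 + a\<^sup>2 = 2 * (norm (x m))\<^sup>2 + 2 * (norm (x n))\<^sup>2"
          by (simp add: a_def norm_diff_sq norm_add_sq)
        moreover have "(norm (x m))\<^sup>2 \<le> 1" "(norm (x n))\<^sup>2 \<le> 1"
          using x1 by (auto simp: abs_square_le_1)
        ultimately have "(norm (x m - x n))\<^sup>2 < e\<^sup>2"
          by (simp add: algebra_simps power2_eq_square)
        then show ?thesis
          using e by (simp add: dist_norm power_less_imp_less_base)
      qed
      then show "\<exists>N. \<forall>m\<ge>N. \<forall>n\<ge>N. dist (x m) (x n) < e" by blast
    qed
    then obtain v where v: "x \<longlonglongrightarrow> v"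
      using Cauchy_convergent_iff convergent_def by blast
    have vM: "v \<in> M"
      using ortho_complement_lim[OF _ v, of V] xB by (simp add: M_def B_def)
    have "norm v \<le> 1"
      using LIMSEQ_le_const2[OF tendsto_norm[OF v], of 1] xB by (auto simp: B_def)
    moreover have "norm (A v) = s"
      using LIMSEQ_unique[OF lim bounded_linear.tendsto[OF bl v]] ny by simp
    ultimately show ?thesis
      using vM le_s by (intro bexI[of _ v]) (auto simp: B_def M_def)
  qed
qed

text \<open>
  First-order variation: perturbing a maximiser \<open>v\<close> in the direction \<open>w\<close> orthogonal to it changes
  the norm of \<open>v\<close> only to second order, so the first-order term of the norm of \<open>A v\<close> vanishes.
\<close>

lemma maximiser_image_orthogonal:
  fixes A :: "'a::complex_hilbert_space \<Rightarrow> 'a"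
  assumes lin: "clinear A"
    and v: "v \<in> ortho_complement V" "norm v = 1"
    and bound: "\<And>z. z \<in> ortho_complement V \<Longrightarrow> norm (A z) \<le> norm (A v) * norm z"
    and w: "w \<in> ortho_complement V" "cinner w v = 0"
  shows "cinner (A w) (A v) = 0"
proof (rule ccontr)
  assume "cinner (A w) (A v) \<noteq> 0"
  define q where "q = cinner (A v) (A w)"
  define Q where "Q = (cmod q)\<^sup>2"
  define s where "s = norm (A v)"
  have Q: "0 < Q"
    using \<open>cinner (A w) (A v) \<noteq> 0\<close> cinner_commute[of "A w" "A v"] by (simp add: Q_def q_def)
  have vw: "cinner v w = 0"
    using w(2) cinner_commute[of v w] by simp
  have *: "2 * t \<le> t\<^sup>2 * (s\<^sup>2 * (norm w)\<^sup>2)" for t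
  proof -
    \<comment> \<open>The factor \<open>q\<close> rotates \<open>w\<close> so that the cross term in
      the norm of \<open>A z\<close> is the real number \<open>t * Q\<close>.\<close>
    define z where "z = v + (t * q) *\<^sub>C w"
    have "z \<in> ortho_complement V"
      unfolding z_def by (intro ortho_complement_add ortho_complement_scaleC v w)
    from bound[OF this] have "(norm (A z))\<^sup>2 \<le> (s * norm z)\<^sup>2"
      by (intro power_mono) (auto simp: s_def)
    moreover have "(norm z)\<^sup>2 = 1 + t\<^sup>2 * Q * (norm w)\<^sup>2"
      by (simp add: z_def norm_add_sq v cinner_scaleC_right vw norm_scaleC norm_mult
          power_mult_distrib Q_def)
    moreover have "cnj q * q = complex_of_real Q"
      unfolding Q_def complex_norm_square by simp
    then have "(norm (A z))\<^sup>2 = s\<^sup>2 + t\<^sup>2 * Q * (norm (A w))\<^sup>2 + 2 * (t * Q)"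
      by (simp add: z_def clinear_add[OF lin] clinear_scaleC[OF lin] norm_add_sq s_def
          cinner_scaleC_right norm_scaleC norm_mult power_mult_distrib mult.assoc Q_def
          flip: q_def)
    ultimately have "2 * (t * Q) + t\<^sup>2 * Q * (norm (A w))\<^sup>2 \<le> s\<^sup>2 * (t\<^sup>2 * Q * (norm w)\<^sup>2)"
      by (simp add: power_mult_distrib distrib_left)
    then have "2 * (t * Q) \<le> s\<^sup>2 * (t\<^sup>2 * Q * (norm w)\<^sup>2)"
      using Q by (smt (verit) mult_nonneg_nonneg zero_le_power2)
    then have "Q * (2 * t) \<le> Q * (t\<^sup>2 * (s\<^sup>2 * (norm w)\<^sup>2))"
      by (simp add: mult_ac)
    then show ?thesis
      using Q by simp
  qed
  define c where "c = s\<^sup>2 * (norm w)\<^sup>2"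
  have c: "c \<ge> 0" by (simp add: c_def)
  \<comment> \<open>With \<open>r * c \<le> 1\<close> the quadratic right-hand side of
    \<open>*\<close> is at most \<open>r\<close>, while the left-hand side is
    \<open>2 * r\<close>.\<close>
  define r where "r = 1 / (c + 1)"
  have r: "0 < r" "r * c \<le> 1" using c by (auto simp: r_def)
  have "2 * r \<le> r * (r * c)"
    using *[of r] by (simp add: c_def power2_eq_square mult_ac)
  also have "\<dots> \<le> r * 1"
    using r by (intro mult_left_mono) auto
  finally show False using r(1) by simp
qed

text \<open>The right vectors \<open>v k\<close> are chosen recursively, each maximising the norm of
  the image over the unit ball of the complement of its predecessors. The maxima are the singular
  values, and the normalised images, orthogonal by \<open>maximiser_image_orthogonal\<close>, are
  the left vectors.\<close>

lemma compact_operator_has_svd: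
  fixes A :: "'a::complex_hilbert_space \<Rightarrow> 'a"
  assumes "compact_operator A"
  shows "\<exists>s u v. is_svd A s u v"
proof -
  have lin: "clinear A" and cpt: "compact (closure (A ` cball 0 1))"
    using assms by (auto simp: compact_operator_def)
  \<comment> \<open>Only vectors with nonzero image impose orthogonality: a maximiser with zero
    image need not have unit norm and contributes nothing to the decomposition.\<close>
  define V where "V v k = {v j | j. j < k \<and> A (v j) \<noteq> 0}" for v :: "nat \<Rightarrow> 'a" and k
  define P where "P v k x \<longleftrightarrow> x \<in> ortho_complement (V v k) \<and> norm x \<le> 1 \<and>
    (\<forall>w\<in>ortho_complement (V v k). norm w \<le> 1 \<longrightarrow> norm (A w) \<le> norm (A x))" for v k x
  have "\<exists>v. \<forall>k. P v k (v k)"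
  \<comment> \<open>The recursion is legitimate because \<open>P v k x\<close> depends only on the
    values of \<open>v\<close> below \<open>k\<close>.\<close>
  proof (rule dependent_wellorder_choice)
    show "P f x r = P g x r" if "\<And>y. y < x \<Longrightarrow> f y = g y" for r f g x
    proof -
      have "V f x = V g x" using that by (force simp: V_def)
      then show ?thesis by (simp add: P_def)
    qed
    show "\<exists>r. P f x r" for x f
      using compact_operator_maximiser[OF assms, of "V f x"] by (auto simp: P_def)
  qed
  then obtain v where v: "\<And>k. P v k (v k)" by blast
  define M where "M k = ortho_complement (V v k)" for k
  define s where "s k = norm (A (v k))" for k
  define I where "I = {k. s k > 0}"
  define u where "u k = (1 / complex_of_real (s k)) *\<^sub>C A (v k)" for k
  have I: "k \<in> I \<longleftrightarrow> A (v k) \<noteq> 0" for k by (simp add: I_def s_def)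
  have vM: "v k \<in> M k" and v1: "norm (v k) \<le> 1" for k
    using v by (auto simp: P_def M_def)
  have hom: "norm (A z) \<le> s k * norm z" if "z \<in> M k" for z k
  proof (rule clinear_bound_homogeneous[OF lin, of "M k"])
    show "norm (A w) \<le> s k" if "w \<in> M k" "norm w \<le> 1" for w
      using v[of k] that by (auto simp: P_def M_def s_def)
  qed (use that in \<open>auto simp: M_def ortho_complement_scaleC\<close>)
  \<comment> \<open>The vector attains its own bound, \<open>s k \<le> s k * norm (v k)\<close>,
    which forces unit norm when \<open>s k\<close> is positive.\<close>
  have nv: "norm (v k) = 1" if "k \<in> I" for k
    using hom[OF vM, of k] v1[of k] that by (simp add: I_def s_def)
  have Mj: "w \<in> M k \<Longrightarrow> j < k \<Longrightarrow> j \<in> I \<Longrightarrow> cinner w (v j) = 0" for w j k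
    by (auto simp: M_def ortho_complement_def V_def I)
  have MI: "(\<And>j. j < k \<Longrightarrow> j \<in> I \<Longrightarrow> cinner w (v j) = 0) \<Longrightarrow> w \<in> M k" for w k
    by (auto simp: M_def ortho_complement_def V_def I)
  have ov: "cinner (v k) (v j) = 0" and oA: "cinner (A (v k)) (A (v j)) = 0"
    if jk: "j < k" "j \<in> I" for j k
  proof -
    show *: "cinner (v k) (v j) = 0" by (rule Mj[OF vM jk])
    show "cinner (A (v k)) (A (v j)) = 0"
    proof (rule maximiser_image_orthogonal[OF lin, of _ "V v j"])
      show "v k \<in> ortho_complement (V v j)"
        unfolding M_def[symmetric] by (rule MI) (use Mj[OF vM, of _ k] jk in simp)
    qed (use * vM[of j] nv[OF jk(2)] hom[of _ j] in \<open>auto simp: M_def s_def\<close>)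
  qed
  have fam: "orthonormal_family I w"
    if "\<And>j k. j < k \<Longrightarrow> j \<in> I \<Longrightarrow> k \<in> I \<Longrightarrow> cinner (w k) (w j) = 0" "\<And>k. k \<in> I \<Longrightarrow> norm (w k) = 1"
    for w :: "nat \<Rightarrow> 'a"
    unfolding orthonormal_family_def
  proof (intro ballI)
    fix j k assume jk: "j \<in> I" "k \<in> I"
    consider "j = k" | "j < k" | "k < j" by linarith
    then show "cinner (w j) (w k) = (if j = k then 1 else 0)"
      by cases (use that jk cinner_commute[of "w j" "w k"] in \<open>auto simp: cinner_self\<close>)
  qed
  have v_on: "orthonormal_family I v"
    using ov nv by (intro fam) auto
  have u_on: "orthonormal_family I u"
  proof (rule fam)
    show "norm (u k) = 1" if "k \<in> I" for k
      using that by (simp add: u_def norm_scaleC norm_divide I_def s_def)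
  qed (simp add: u_def cinner_scaleC_left cinner_scaleC_right oA)
  have su: "complex_of_real (s k) *\<^sub>C u k = A (v k)" for k
    by (cases "s k = 0") (simp_all add: u_def scaleC_scaleC s_def)
  have dec: "decseq s"
  proof (rule decseq_SucI)
    fix k
    have "v (Suc k) \<in> M k"
      by (rule MI) (use Mj[OF vM, of _ "Suc k"] in simp)
    then show "s (Suc k) \<le> s k"
      using v[of k] v1 by (auto simp: P_def M_def s_def)
  qed
  \<comment> \<open>Otherwise the images \<open>A (v n)\<close> would be pairwise orthogonal with
    norms at least \<open>e\<close>, hence pairwise at distance at least \<open>e\<close>, and could
    have no convergent subsequence.\<close>
  have "s \<longlonglongrightarrow> 0"
  proof (rule ccontr)
    assume "\<not> s \<longlonglongrightarrow> 0"
    then obtain e where e: "0 < e" "\<And>N. \<exists>n\<ge>N. e \<le> s n"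
      by (auto simp: LIMSEQ_iff s_def not_less)
    have se: "e \<le> s n" for n
      using e(2)[of n] decseqD[OF dec] order_trans by blast
    then have In: "n \<in> I" for n using e(1) by (smt (verit) I_def mem_Collect_eq)
    have "A (v n) \<in> closure (A ` cball 0 1)" for n
      using v1[of n] closure_subset by fastforce
    then obtain y r where r: "strict_mono r" "((\<lambda>n. A (v n)) \<circ> r) \<longlonglongrightarrow> y"
      using compact_imp_seq_compact[OF cpt] unfolding seq_compact_def by metis
    then have "Cauchy ((\<lambda>n. A (v n)) \<circ> r)" by (metis LIMSEQ_imp_Cauchy)
    then obtain N where N: "\<And>m n. m \<ge> N \<Longrightarrow> n \<ge> N \<Longrightarrow> norm (A (v (r m)) - A (v (r n))) < e"
      using e(1) unfolding Cauchy_iff comp_def by blast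
    have "r N < r (Suc N)" using r(1) by (simp add: strict_mono_Suc_iff)
    then have "cinner (A (v (r (Suc N)))) (A (v (r N))) = 0" using oA In by blast
    then have "(norm (A (v (r (Suc N))) - A (v (r N))))\<^sup>2 = (s (r (Suc N)))\<^sup>2 + (s (r N))\<^sup>2"
      by (simp add: norm_diff_sq s_def)
    moreover have "e\<^sup>2 \<le> (s (r N))\<^sup>2" using se e(1) by (intro power_mono) auto
    ultimately have "e\<^sup>2 \<le> (norm (A (v (r (Suc N))) - A (v (r N))))\<^sup>2"
      by (smt (verit) zero_le_power2)
    then show False
      using N[of "Suc N" N] e(1) by (simp add: power_mono_iff)
  qed
  \<comment> \<open>The truncation error is \<open>- A z\<close> with \<open>z\<close> the residual
    of \<open>h\<close>; it lies in \<open>M N\<close>, where \<open>A\<close> is bounded by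
    \<open>s N\<close>.\<close>
  have "(\<lambda>n. (complex_of_real (s n) * cinner h (v n)) *\<^sub>C u n) sums A h" for h
    unfolding sums_def
  proof (rule LIM_zero_cancel, rule tendsto_0_le[where K = "norm h"])
    show "s \<longlonglongrightarrow> 0" by fact
    show "\<forall>\<^sub>F N in sequentially.
      norm ((\<Sum>n<N. (complex_of_real (s n) * cinner h (v n)) *\<^sub>C u n) - A h) \<le> norm (s N) * norm h"
    proof (intro always_eventually allI)
      fix N
      define S where "S = {..<N} \<inter> I"
      define z where "z = h - (\<Sum>n\<in>S. cinner h (v n) *\<^sub>C v n)"
      have S: "finite S" "orthonormal_family S v"
        using orthonormal_family_subset[OF v_on] by (auto simp: S_def)
      have "cinner z (v j) = 0" if "j < N" "j \<in> I" for j
        unfolding z_def by (rule residual_orthogonal[OF S(2,1)]) (use that in \<open>simp add: S_def\<close>)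
      then have "norm (A z) \<le> s N * norm z"
        by (intro hom MI)
      also have "(norm z)\<^sup>2 \<le> (norm h)\<^sup>2"
        using bessel_residual[OF S(2,1), of h] unfolding z_def
        by (smt (verit) sum_nonneg zero_le_power2)
      then have "norm z \<le> norm h" by simp
      then have "s N * norm z \<le> s N * norm h"
        by (intro mult_left_mono) (auto simp: s_def)
      finally have *: "norm (A z) \<le> s N * norm h" .
      have "(\<Sum>n<N. (complex_of_real (s n) * cinner h (v n)) *\<^sub>C u n) = (\<Sum>n<N. cinner h (v n) *\<^sub>C A (v n))"
        by (simp add: su[symmetric] scaleC_scaleC mult.commute)
      also have "\<dots> = (\<Sum>n\<in>S. cinner h (v n) *\<^sub>C A (v n))"
        by (intro sum.mono_neutral_right) (auto simp: S_def I)
      also have "\<dots> - A h = - A z"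
        by (simp add: z_def clinear_diff[OF lin] clinear_sum[OF lin] clinear_scaleC[OF lin])
      finally show "norm ((\<Sum>n<N. (complex_of_real (s n) * cinner h (v n)) *\<^sub>C u n) - A h) \<le> norm (s N) * norm h"
        using * by (simp add: s_def)
    qed
  qed
  then have "is_svd A s u v"
    unfolding is_svd_def orthonormal_on_iff_family
    using dec \<open>s \<longlonglongrightarrow> 0\<close> u_on v_on by (simp add: I_def)
  then show ?thesis by blast
qed

section \<open>Partial sums of squared singular values\<close>

text \<open>A decreasing sequence with limit 0 is nonnegative, so positivity of \<open>s n\<close>
  can be restated as \<open>s n \<noteq> 0\<close>, a condition that also makes sense for complex
  coefficients.\<close>

lemma is_svdD:
  assumes "is_svd A s u v"
  shows "decseq s" "s \<longlonglongrightarrow> 0" "\<And>n. 0 \<le> s n"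
    "orthonormal_family {n. s n \<noteq> 0} u" "orthonormal_family {n. s n \<noteq> 0} v"
    "\<And>h. (\<lambda>n. (complex_of_real (s n) * cinner h (v n)) *\<^sub>C u n) sums A h"
proof -
  show s: "decseq s" "s \<longlonglongrightarrow> 0"
    and "\<And>h. (\<lambda>n. (complex_of_real (s n) * cinner h (v n)) *\<^sub>C u n) sums A h"
    using assms by (auto simp: is_svd_def)
  show nn: "\<And>n. 0 \<le> s n" using decseq_ge s by metis
  then have "{n. s n > 0} = {n. s n \<noteq> 0}" by (simp add: order_less_le)
  then show "orthonormal_family {n. s n \<noteq> 0} u" "orthonormal_family {n. s n \<noteq> 0} v"
    using assms by (auto simp: is_svd_def orthonormal_on_iff_family)
qed

lemma norm_sum_expansion:
  assumes "orthonormal_family {n. a n \<noteq> 0} u" "finite S"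
  shows "(norm (\<Sum>n\<in>S. (a n * cinner h (v n)) *\<^sub>C u n))\<^sup>2 = (\<Sum>n\<in>S. (cmod (a n))\<^sup>2 * (cmod (cinner h (v n)))\<^sup>2)"
  using norm_sum_orthonormal[OF assms(1), of S "\<lambda>n. a n * cinner h (v n)"] assms(2)
  by (simp add: norm_mult power_mult_distrib)

text \<open>After interchanging the sums, each coefficient is weighted by a Bessel sum of the unit
  vector \<open>v n\<close> over \<open>F\<close>.\<close>

lemma sum_norm_expansion_le:
  assumes u: "orthonormal_family {n. a n \<noteq> 0} u" and v: "orthonormal_family {n. a n \<noteq> 0} v"
    and S: "finite S" and F: "finite F" "orthonormal_set F"
  shows "(\<Sum>e\<in>F. (norm (\<Sum>n\<in>S. (a n * cinner e (v n)) *\<^sub>C u n))\<^sup>2) \<le> (\<Sum>n\<in>S. (cmod (a n))\<^sup>2)"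
proof -
  have "(\<Sum>e\<in>F. (norm (\<Sum>n\<in>S. (a n * cinner e (v n)) *\<^sub>C u n))\<^sup>2)
    = (\<Sum>n\<in>S. (cmod (a n))\<^sup>2 * (\<Sum>e\<in>F. (cmod (cinner (v n) e))\<^sup>2))"
    unfolding norm_sum_expansion[OF u S] sum_distrib_left
    by (subst sum.swap) (simp add: norm_cinner_commute)
  also have "\<dots> \<le> (\<Sum>n\<in>S. (cmod (a n))\<^sup>2)"
  proof (rule sum_mono)
    fix n
    show "(cmod (a n))\<^sup>2 * (\<Sum>e\<in>F. (cmod (cinner (v n) e))\<^sup>2) \<le> (cmod (a n))\<^sup>2"
    proof (cases "a n = 0")
      case False
      then have "norm (v n) = 1" using orthonormal_family_norm[OF v] by simp
      then show ?thesis using bessel[OF F(2,1), of "v n"]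
        by (intro mult_left_le) auto
    qed simp
  qed
  finally show ?thesis .
qed

text \<open>
  The weights \<open>w k\<close> lie in \<open>[0, 1]\<close> and add up to at most \<open>card F\<close>, so the weighted sum of the
  decreasing sequence is largest when the first \<open>card F\<close> weights are \<open>1\<close>.
\<close>

lemma svd_ky_fan_le:
  assumes svd: "is_svd A s u v" and F: "finite F" "orthonormal_set F" "card F \<le> N"
  shows "(\<Sum>e\<in>F. (norm (A e))\<^sup>2) \<le> (\<Sum>k<N. (s k)\<^sup>2)"
proof -
  note S = is_svdD[OF svd]
  let ?p = "\<lambda>K e. \<Sum>n<K. (complex_of_real (s n) * cinner e (v n)) *\<^sub>C u n"
  define I where "I = {n. s n \<noteq> 0}"
  have "(\<lambda>K. \<Sum>e\<in>F. (norm (?p K e))\<^sup>2) \<longlonglongrightarrow> (\<Sum>e\<in>F. (norm (A e))\<^sup>2)"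
    using S(6) unfolding sums_def by (intro tendsto_intros)
  moreover have "(\<Sum>e\<in>F. (norm (?p K e))\<^sup>2) \<le> (\<Sum>k<N. (s k)\<^sup>2)" if "N \<le> K" for K
  proof -
    \<comment> \<open>The weight is set to 0 where \<open>s k = 0\<close>, since \<open>v k\<close>
      is arbitrary there and might spoil both bounds on the weights.\<close>
    define w where "w k = (if k \<in> I then \<Sum>e\<in>F. (cmod (cinner e (v k)))\<^sup>2 else 0)" for k
    have w0: "0 \<le> w k" for k by (simp add: w_def sum_nonneg)
    have w1: "w k \<le> 1" for k
      using bessel[OF F(2,1), of "v k"] orthonormal_family_norm[OF S(5), of k]
      by (auto simp: w_def I_def norm_cinner_commute[of "v k"])
    have "(\<Sum>k<K. w k) = (\<Sum>k\<in>{..<K} \<inter> I. \<Sum>e\<in>F. (cmod (cinner e (v k)))\<^sup>2)"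
      by (rule sum.mono_neutral_cong_right) (auto simp: w_def)
    also have "\<dots> = (\<Sum>e\<in>F. \<Sum>k\<in>{..<K} \<inter> I. (cmod (cinner e (v k)))\<^sup>2)"
      by (rule sum.swap)
    also have "\<dots> \<le> (\<Sum>e\<in>F. (norm e)\<^sup>2)"
      by (intro sum_mono bessel orthonormal_family_subset[OF S(5)]) (auto simp: I_def)
    also have "\<dots> = card F"
      using orthonormal_family_norm[OF F(2)] by simp
    also have "\<dots> \<le> N" using F(3) by simp
    finally have wN: "(\<Sum>k<K. w k) \<le> N" .
    have split: "(\<Sum>k<K. g k) = (\<Sum>k<N. g k) + (\<Sum>k=N..<K. g k)" for g :: "nat \<Rightarrow> real"
      using sum.atLeastLessThan_concat[of 0 N K g] that by (simp add: lessThan_atLeast0)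
    have "(\<Sum>e\<in>F. (norm (?p K e))\<^sup>2) = (\<Sum>k<K. (s k)\<^sup>2 * w k)"
    proof -
      have "(\<Sum>e\<in>F. (norm (?p K e))\<^sup>2) = (\<Sum>e\<in>F. \<Sum>k<K. (s k)\<^sup>2 * (cmod (cinner e (v k)))\<^sup>2)"
        using norm_sum_expansion[of "\<lambda>n. complex_of_real (s n)" u "{..<K}" _ v] S(4)
        by (intro sum.cong refl) simp
      also have "\<dots> = (\<Sum>k<K. \<Sum>e\<in>F. (s k)\<^sup>2 * (cmod (cinner e (v k)))\<^sup>2)"
        by (rule sum.swap)
      also have "\<dots> = (\<Sum>k<K. (s k)\<^sup>2 * w k)"
        by (intro sum.cong refl) (simp add: w_def I_def sum_distrib_left)
      finally show ?thesis .
    qed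
    \<comment> \<open>From \<open>N\<close> on, \<open>s k\<close> is replaced by
      \<open>s N\<close>. The weight found there fits into the room left below \<open>N\<close>,
      where each \<open>s k\<close> is at least \<open>s N\<close>.\<close>
    also have "\<dots> \<le> (\<Sum>k<N. (s k)\<^sup>2 * w k) + (\<Sum>k=N..<K. (s N)\<^sup>2 * w k)"
      unfolding split using S(3) w0
      by (intro add_left_mono sum_mono mult_right_mono power_mono decseqD[OF S(1)]) auto
    also have "\<dots> = (\<Sum>k<N. (s k)\<^sup>2 * w k) + (s N)\<^sup>2 * ((\<Sum>k<K. w k) - (\<Sum>k<N. w k))"
      unfolding split by (simp add: sum_distrib_left)
    also have "\<dots> \<le> (\<Sum>k<N. (s k)\<^sup>2 * w k) + (s N)\<^sup>2 * (real N - (\<Sum>k<N. w k))"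
      using wN by (intro add_left_mono mult_left_mono) auto
    also have "\<dots> = (\<Sum>k<N. (s k)\<^sup>2 * w k + (s N)\<^sup>2 * (1 - w k))"
      by (simp add: sum.distrib sum_subtractf sum_distrib_left right_diff_distrib)
    also have "\<dots> \<le> (\<Sum>k<N. (s k)\<^sup>2 * w k + (s k)\<^sup>2 * (1 - w k))"
      using S(3) w1
      by (intro sum_mono add_left_mono mult_right_mono power_mono decseqD[OF S(1)]) auto
    also have "\<dots> = (\<Sum>k<N. (s k)\<^sup>2)" by (simp add: algebra_simps)
    finally show ?thesis .
  qed
  ultimately show ?thesis
    by (intro LIMSEQ_le_const2) blast+
qed

lemma svd_apply_right_vector:
  assumes "is_svd A s u v" "s k \<noteq> 0"
  shows "A (v k) = complex_of_real (s k) *\<^sub>C u k"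
proof -
  note S = is_svdD[OF assms(1)]
  have "(complex_of_real (s n) * cinner (v k) (v n)) *\<^sub>C u n
      = (if n = k then complex_of_real (s k) *\<^sub>C u k else 0)" for n
    using orthonormal_familyD[OF S(5), of k n] assms(2) by (cases "s n = 0") auto
  then show ?thesis
    using S(6)[of "v k"] sums_single[of k "\<lambda>n. complex_of_real (s k) *\<^sub>C u k"]
    by (simp add: sums_unique2)
qed

text \<open>The right singular vectors with nonzero value attain the bound of
  \<open>svd_ky_fan_le\<close>. The partial sums are therefore maxima defined by \<open>A\<close>
  alone.\<close>

lemma svd_ky_fan_attained:
  assumes svd: "is_svd A s u v"
  shows "\<exists>F. finite F \<and> orthonormal_set F \<and> card F \<le> N \<and> (\<Sum>e\<in>F. (norm (A e))\<^sup>2) = (\<Sum>k<N. (s k)\<^sup>2)"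
proof -
  note S = is_svdD[OF svd]
  define J where "J = {..<N} \<inter> {n. s n \<noteq> 0}"
  have vJ: "orthonormal_family J v"
    by (rule orthonormal_family_subset[OF S(5)]) (auto simp: J_def)
  have "(\<Sum>e\<in>v ` J. (norm (A e))\<^sup>2) = (\<Sum>k\<in>J. (norm (A (v k)))\<^sup>2)"
    using orthonormal_family_inj[OF vJ] by (simp add: sum.reindex)
  also have "\<dots> = (\<Sum>k\<in>J. (s k)\<^sup>2)"
    using svd_apply_right_vector[OF svd] orthonormal_family_norm[OF S(4)]
    by (intro sum.cong) (auto simp: J_def norm_scaleC)
  also have "\<dots> = (\<Sum>k<N. (s k)\<^sup>2)"
    by (rule sum.mono_neutral_left) (auto simp: J_def)
  moreover have "card (v ` J) \<le> N"
    using card_image_le[of J v] card_mono[of "{..<N}" J] by (auto simp: J_def)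
  moreover have "finite (v ` J)" by (simp add: J_def)
  ultimately show ?thesis using orthonormal_family_image[OF vJ] by metis
qed

text \<open>Both sequences have partial sums equal to the same maximum over orthonormal sets of at
  most \<open>N\<close> vectors; consecutive differences recover the terms.\<close>

lemma svd_singular_values_unique:
  assumes "is_svd A s u v" "is_svd A t x y"
  shows "s = t"
proof -
  have *: "(\<Sum>k<N. (s k)\<^sup>2) \<le> (\<Sum>k<N. (t k)\<^sup>2)"
    if "is_svd A s u v" "is_svd A t x y" for s t u v x y N
    using svd_ky_fan_attained[OF that(1), of N] svd_ky_fan_le[OF that(2)] by metis
  have eq: "(\<Sum>k<N. (s k)\<^sup>2) = (\<Sum>k<N. (t k)\<^sup>2)" for N
    using *[OF assms] *[OF assms(2,1)] by (rule antisym)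
  have "(s n)\<^sup>2 = (t n)\<^sup>2" for n
    using eq[of n] eq[of "Suc n"] by simp
  then show ?thesis
    using is_svdD(3)[OF assms(1)] is_svdD(3)[OF assms(2)] by (intro ext) (simp add: power2_eq_iff_nonneg)
qed

lemma is_svd_singular_value: "is_svd A s u v \<Longrightarrow> singular_value A = s"
  unfolding singular_value_def using svd_singular_values_unique by (intro the_equality) blast+

lemma compact_operator_svd:
  "compact_operator A \<Longrightarrow> \<exists>u v. is_svd A (singular_value A) u v"
  using compact_operator_has_svd is_svd_singular_value by metis

section \<open>Hilbert-Schmidt operators via finite orthonormal sets\<close>

lemma hilbert_schmidt_sum_le:
  assumes A: "A \<in> hilbert_schmidt" and F: "finite F" "orthonormal_set F"
  shows "(\<Sum>e\<in>F. (norm (A e))\<^sup>2) \<le> (hs_norm A)\<^sup>2"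
proof -
  have cpt: "compact_operator A" and sm: "summable (\<lambda>n. (singular_value A n)\<^sup>2)"
    using A by (auto simp: hilbert_schmidt_def)
  obtain u v where svd: "is_svd A (singular_value A) u v"
    using compact_operator_svd[OF cpt] by blast
  have "(\<Sum>e\<in>F. (norm (A e))\<^sup>2) \<le> (\<Sum>k<card F. (singular_value A k)\<^sup>2)"
    by (rule svd_ky_fan_le[OF svd F order_refl])
  also have "\<dots> \<le> (\<Sum>k. (singular_value A k)\<^sup>2)"
    by (intro sum_le_suminf sm) auto
  also have "\<dots> = (hs_norm A)\<^sup>2"
    using sm by (simp add: hs_norm_def suminf_nonneg)
  finally show ?thesis .
qed

text \<open>By induction, the set is a Minkowski sum of continuous images of the closed unit
  disc.\<close>

lemma compact_bounded_combinations:
  fixes w :: "'i \<Rightarrow> 'a::complex_hilbert_space"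
  assumes "finite F"
  shows "compact {\<Sum>e\<in>F. c e *\<^sub>C w e | c. \<forall>e\<in>F. cmod (c e) \<le> 1}"
  using assms
proof induction
  case (insert a F)
  let ?K = "\<lambda>F. {\<Sum>e\<in>F. c e *\<^sub>C w e | c. \<forall>e\<in>F. cmod (c e) \<le> 1}"
  have "?K (insert a F) = {p + q | p q. p \<in> (\<lambda>z. z *\<^sub>C w a) ` cball 0 1 \<and> q \<in> ?K F}" (is "_ = ?R")
  proof
    show "?K (insert a F) \<subseteq> ?R" using insert.hyps by fastforce
    show "?R \<subseteq> ?K (insert a F)"
    proof
      fix r assume "r \<in> ?R"
      then obtain z c where zc: "r = z *\<^sub>C w a + (\<Sum>e\<in>F. c e *\<^sub>C w e)" "cmod z \<le> 1" "\<forall>e\<in>F. cmod (c e) \<le> 1"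
        by auto
      have "(\<Sum>e\<in>F. (c(a := z)) e *\<^sub>C w e) = (\<Sum>e\<in>F. c e *\<^sub>C w e)"
        using insert.hyps by (intro sum.cong) auto
      then have "r = (\<Sum>e\<in>insert a F. (c(a := z)) e *\<^sub>C w e)"
        using insert.hyps zc(1) by simp
      moreover have "\<forall>e\<in>insert a F. cmod ((c(a := z)) e) \<le> 1" using zc by auto
      ultimately show "r \<in> ?K (insert a F)" by blast
    qed
  qed
  moreover have "compact ((\<lambda>z. z *\<^sub>C w a) ` cball 0 1)"
    by (intro compact_continuous_image continuous_on_scaleC_left compact_cball)
  ultimately show ?case using compact_sums[OF _ insert.IH] by (simp only:)
qed simp

text \<open>
  If \<open>F\<close> nearly attains the supremum of the sums, then \<open>A\<close> is small on the orthogonal complement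
  of \<open>F\<close>, so the image of the unit ball is close to a finite-dimensional compact set.
\<close>

lemma bounded_sums_imp_compact_operator:
  fixes A :: "'a::complex_hilbert_space \<Rightarrow> 'a"
  assumes lin: "clinear A"
    and bound: "\<And>F. finite F \<Longrightarrow> orthonormal_set F \<Longrightarrow> (\<Sum>e\<in>F. (norm (A e))\<^sup>2) \<le> C"
  shows "compact_operator A"
proof -
  have "\<exists>k. finite k \<and> closure (A ` cball 0 1) \<subseteq> (\<Union>x\<in>k. ball x \<epsilon>)" if "0 < \<epsilon>" for \<epsilon> :: real
  proof -
    \<comment> \<open>Three errors are added at the end: from the net to \<open>A p\<close>, from
      \<open>A p\<close> to \<open>A h\<close>, and from \<open>A h\<close> to the point of the
      closure.\<close>
    define d where "d = \<epsilon> / 3"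
    have d: "0 < d" using that by (simp add: d_def)
    define ON where "ON = {F :: 'a set. finite F \<and> orthonormal_set F}"
    define sig where "sig = (SUP F\<in>ON. \<Sum>e\<in>F. (norm (A e))\<^sup>2)"
    have bdd: "bdd_above ((\<lambda>F. \<Sum>e\<in>F. (norm (A e))\<^sup>2) ` ON)"
      by (rule bdd_aboveI2[of _ _ C]) (use bound in \<open>simp add: ON_def\<close>)
    have "{} \<in> ON" by (simp add: ON_def orthonormal_family_def)
    then obtain F where F: "F \<in> ON" "sig - d\<^sup>2 < (\<Sum>e\<in>F. (norm (A e))\<^sup>2)"
      using less_cSUP_iff[OF _ bdd, of "sig - d\<^sup>2"] d unfolding sig_def by auto
    have fin: "finite F" and on: "orthonormal_set F" using F(1) by (auto simp: ON_def)
    \<comment> \<open>Adjoining a unit vector orthogonal to \<open>F\<close> raises the sum by the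
      squared norm of its image, but less than \<open>d\<^sup>2\<close> separates \<open>F\<close>
      from the supremum.\<close>
    have small: "norm (A g) \<le> d * norm g" if "g \<in> ortho_complement F" for g
    proof (cases "g = 0")
      case False
      define g' where "g' = (1 / complex_of_real (norm g)) *\<^sub>C g"
      have g': "norm g' = 1" "g' \<in> ortho_complement F"
        using False that by (auto simp: g'_def norm_scaleC norm_divide intro: ortho_complement_scaleC)
      then have perp: "\<And>e. e \<in> F \<Longrightarrow> cinner g' e = 0"
        by (simp add: ortho_complement_def)
      have "g' \<notin> F" using perp[of g'] g' by (auto simp: cinner_self)
      moreover have "insert g' F \<in> ON"
        using orthonormal_set_insert[OF on g'(1) perp] fin by (simp add: ON_def)
      ultimately have "(norm (A g'))\<^sup>2 + (\<Sum>e\<in>F. (norm (A e))\<^sup>2) \<le> sig"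
        using cSUP_upper[OF _ bdd, of "insert g' F"] fin by (simp add: sig_def)
      then have "(norm (A g'))\<^sup>2 \<le> d\<^sup>2" using F(2) by linarith
      then have "norm (A g') \<le> d" using d by (simp add: power2_le_iff_abs_le)
      then show ?thesis
        using False by (simp add: g'_def clinear_scaleC[OF lin] norm_scaleC norm_divide field_simps)
    qed (simp add: clinear_zero[OF lin])
    define K where "K = {\<Sum>e\<in>F. c e *\<^sub>C A e | c. \<forall>e\<in>F. cmod (c e) \<le> 1}"
    have "compact K" unfolding K_def by (rule compact_bounded_combinations[OF fin])
    then obtain k where k: "finite k" "K \<subseteq> (\<Union>x\<in>k. ball x d)"
      using d unfolding compact_eq_totally_bounded by blast
    have "closure (A ` cball 0 1) \<subseteq> (\<Union>x\<in>k. ball x \<epsilon>)"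
    proof
      fix y assume "y \<in> closure (A ` cball 0 1)"
      then obtain h where h: "norm h \<le> 1" "dist (A h) y < d"
        using d by (auto simp: closure_approachable)
      define p where "p = (\<Sum>e\<in>F. cinner h e *\<^sub>C e)"
      have "h - p \<in> ortho_complement F"
        unfolding ortho_complement_def p_def using residual_orthogonal[OF on fin] by simp
      then have "norm (A h - A p) \<le> d * norm (h - p)"
        using small by (simp flip: clinear_diff[OF lin])
      moreover have "(norm (h - p))\<^sup>2 \<le> (norm h)\<^sup>2"
        unfolding p_def bessel_residual[OF on fin] by (simp add: sum_nonneg)
      then have "norm (h - p) \<le> 1" using h(1) by simp
      then have "d * norm (h - p) \<le> d" using d by (intro mult_left_le) auto
      ultimately have hp: "dist (A p) (A h) \<le> d"
        by (simp add: dist_norm norm_minus_commute)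
      have "cmod (cinner h e) \<le> 1" if "e \<in> F" for e
      proof -
        have "(cmod (cinner h e))\<^sup>2 \<le> (\<Sum>e\<in>F. (cmod (cinner h e))\<^sup>2)"
          by (rule member_le_sum[OF that]) (use fin in auto)
        also have "\<dots> \<le> (norm h)\<^sup>2" by (rule bessel[OF on fin])
        finally have "cmod (cinner h e) \<le> norm h" by simp
        then show ?thesis using h(1) by simp
      qed
      moreover have "A p = (\<Sum>e\<in>F. cinner h e *\<^sub>C A e)"
        by (simp add: p_def clinear_sum[OF lin] clinear_scaleC[OF lin])
      ultimately have "A p \<in> K" unfolding K_def by blast
      then obtain x where x: "x \<in> k" "dist x (A p) < d" using k(2) by auto
      have "dist x y \<le> dist x (A p) + (dist (A p) (A h) + dist (A h) y)"
        by (meson add_left_mono dist_triangle order_trans)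
      then have "dist x y < \<epsilon>" using x(2) hp h(2) by (simp add: d_def)
      then show "y \<in> (\<Union>x\<in>k. ball x \<epsilon>)" using x(1) by auto
    qed
    then show ?thesis using k(1) by blast
  qed
  then have "compact (closure (A ` cball 0 1))"
    unfolding compact_eq_totally_bounded by (simp add: complete_eq_closed)
  then show ?thesis using lin by (simp add: compact_operator_def)
qed

text \<open>Converse to \<open>hilbert_schmidt_sum_le\<close>: on the Hilbert-Schmidt class,
  \<open>hs_norm\<close> is the least bound for these sums, and norm estimates no longer need the
  singular values of the operator concerned.\<close>

lemma hilbert_schmidtI:
  fixes A :: "'a::complex_hilbert_space \<Rightarrow> 'a"
  assumes lin: "clinear A" and c: "0 \<le> c"
    and bound: "\<And>F. finite F \<Longrightarrow> orthonormal_set F \<Longrightarrow> (\<Sum>e\<in>F. (norm (A e))\<^sup>2) \<le> c\<^sup>2"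
  shows "A \<in> hilbert_schmidt" and "hs_norm A \<le> c"
proof -
  have cpt: "compact_operator A"
    by (rule bounded_sums_imp_compact_operator[OF lin bound])
  obtain u v where svd: "is_svd A (singular_value A) u v"
    using compact_operator_svd[OF cpt] by blast
  have le: "(\<Sum>k<N. (singular_value A k)\<^sup>2) \<le> c\<^sup>2" for N
    using svd_ky_fan_attained[OF svd, of N] bound by metis
  have sm: "summable (\<lambda>n. (singular_value A n)\<^sup>2)"
    by (rule summableI_nonneg_bounded[OF _ le]) simp
  then show "A \<in> hilbert_schmidt" using cpt by (simp add: hilbert_schmidt_def)
  show "hs_norm A \<le> c"
    unfolding hs_norm_def using suminf_le_const[OF sm le] c by (intro real_le_lsqrt)
qed

lemma hs_norm_nonneg: "A \<in> hilbert_schmidt \<Longrightarrow> 0 \<le> hs_norm A"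
  by (simp add: hs_norm_def hilbert_schmidt_def suminf_nonneg)

lemma hilbert_schmidt_clinear: "A \<in> hilbert_schmidt \<Longrightarrow> clinear A"
  by (simp add: hilbert_schmidt_def compact_operator_def)

text \<open>Testing on the single unit vector along \<open>h\<close> suffices. This guarantees
  nonzero denominators in the difference quotients.\<close>

lemma hs_norm_eq_0_imp:
  assumes A: "A \<in> hilbert_schmidt" and "hs_norm A = 0"
  shows "A h = 0"
proof (cases "h = 0")
  case False
  define e where "e = (1 / complex_of_real (norm h)) *\<^sub>C h"
  have "norm e = 1" using False by (simp add: e_def norm_scaleC norm_divide)
  then have "orthonormal_set {e}" by (simp add: orthonormal_family_def cinner_self)
  then have "A e = 0" using hilbert_schmidt_sum_le[OF A, of "{e}"] assms(2) by simp
  moreover have "h = complex_of_real (norm h) *\<^sub>C e"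
    using False by (simp add: e_def scaleC_scaleC)
  ultimately show ?thesis
    using clinear_scaleC[OF hilbert_schmidt_clinear[OF A]] by (metis scaleC_zero_right)
qed (simp add: clinear_zero[OF hilbert_schmidt_clinear[OF A]])

text \<open>Minkowski's inequality for the sequence of norms, after the triangle inequality in each
  term.\<close>

lemma sqrt_sum_norm_add_le:
  "sqrt (\<Sum>e\<in>F. (norm (X e + Y e :: 'b::real_normed_vector))\<^sup>2)
    \<le> sqrt (\<Sum>e\<in>F. (norm (X e))\<^sup>2) + sqrt (\<Sum>e\<in>F. (norm (Y e))\<^sup>2)"
proof -
  have "sqrt (\<Sum>e\<in>F. (norm (X e + Y e))\<^sup>2) \<le> L2_set (\<lambda>e. norm (X e) + norm (Y e)) F"
    unfolding L2_set_def by (intro real_sqrt_le_mono sum_mono power_mono norm_triangle_ineq) auto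
  also have "\<dots> \<le> L2_set (\<lambda>e. norm (X e)) F + L2_set (\<lambda>e. norm (Y e)) F"
    by (rule L2_set_triangle_ineq)
  finally show ?thesis by (simp add: L2_set_def)
qed

lemma hilbert_schmidt_diff:
  fixes A B :: "'a::complex_hilbert_space \<Rightarrow> 'a"
  assumes A: "A \<in> hilbert_schmidt" and B: "B \<in> hilbert_schmidt"
  shows "(\<lambda>h. A h - B h) \<in> hilbert_schmidt"
proof (rule hilbert_schmidtI(1))
  note lA = hilbert_schmidt_clinear[OF A] and lB = hilbert_schmidt_clinear[OF B]
  show "clinear (\<lambda>h. A h - B h)"
    using lA lB by (simp add: clinear_iff scaleC_diff_right)
  show "0 \<le> hs_norm A + hs_norm B" using A B by (simp add: hs_norm_nonneg)
  show "(\<Sum>e\<in>F. (norm (A e - B e))\<^sup>2) \<le> (hs_norm A + hs_norm B)\<^sup>2"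
    if F: "finite F" "orthonormal_set F" for F
  proof (rule sqrt_le_D)
    have "sqrt (\<Sum>e\<in>F. (norm (A e - B e))\<^sup>2) \<le> sqrt (\<Sum>e\<in>F. (norm (A e))\<^sup>2) + sqrt (\<Sum>e\<in>F. (norm (B e))\<^sup>2)"
      using sqrt_sum_norm_add_le[of A "\<lambda>e. - B e"] by simp
    also have "\<dots> \<le> hs_norm A + hs_norm B"
      using hilbert_schmidt_sum_le[OF A F] hilbert_schmidt_sum_le[OF B F] hs_norm_nonneg A B
      by (intro add_mono real_le_lsqrt) auto
    finally show "sqrt (\<Sum>e\<in>F. (norm (A e - B e))\<^sup>2) \<le> hs_norm A + hs_norm B" .
  qed
qed

section \<open>Orthonormal expansions\<close>

lemma bounded_linear_scaleC_right: "bounded_linear (\<lambda>x::'a::complex_hilbert_space. c *\<^sub>C x)"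
proof (rule bounded_linear_intro[of _ "cmod c"])
  show "c *\<^sub>C (r *\<^sub>R x) = r *\<^sub>R (c *\<^sub>C x)" for r and x :: 'a
    by (simp add: scaleC_scaleC mult.commute flip: scaleC_of_real)
qed (simp_all add: scaleC_add_right norm_scaleC mult.commute)

instance complex_hilbert_space \<subseteq> banach ..

text \<open>The squared norm of a block of the series is a block of \<open>b\<close>, which is
  dominated by the summable \<open>(cmod (a n))\<^sup>2\<close> times
  \<open>(norm h)\<^sup>2\<close>; the Cauchy criterion applies.\<close>

lemma summable_orthonormal_expansion:
  fixes u v :: "nat \<Rightarrow> 'a::complex_hilbert_space"
  assumes u: "orthonormal_family {n. a n \<noteq> 0} u" and v: "orthonormal_family {n. a n \<noteq> 0} v"
    and a: "summable (\<lambda>n. (cmod (a n))\<^sup>2)"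
  shows "summable (\<lambda>n. (a n * cinner h (v n)) *\<^sub>C u n)"
  unfolding summable_Cauchy
proof (intro allI impI)
  fix e :: real assume e: "0 < e"
  define b where "b n = (cmod (a n))\<^sup>2 * (cmod (cinner h (v n)))\<^sup>2" for n
  have "norm (b n) \<le> (cmod (a n))\<^sup>2 * (norm h)\<^sup>2" for n
  proof (cases "a n = 0")
    case False
    then have "orthonormal_family {n} v" by (intro orthonormal_family_subset[OF v]) simp
    from bessel[OF this, of h] show ?thesis
      by (simp add: b_def mult_left_mono)
  qed (simp add: b_def)
  then have "summable b"
    by (intro summable_comparison_test'[OF summable_mult2[OF a]]) auto
  then obtain N where N: "\<And>m n. m \<ge> N \<Longrightarrow> norm (sum b {m..<n}) < e\<^sup>2"
    using e unfolding summable_Cauchy by (meson zero_less_power)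
  have "norm (\<Sum>n=m..<n. (a n * cinner h (v n)) *\<^sub>C u n) < e" if "m \<ge> N" for m n
  proof -
    have "(norm (\<Sum>n=m..<n. (a n * cinner h (v n)) *\<^sub>C u n))\<^sup>2 < e\<^sup>2"
      unfolding norm_sum_expansion[OF u finite_atLeastLessThan]
      using N[OF that, of n] by (simp add: b_def)
    then show ?thesis using e by (simp add: power_less_imp_less_base)
  qed
  then show "\<exists>N. \<forall>m\<ge>N. \<forall>n. norm (\<Sum>n=m..<n. (a n * cinner h (v n)) *\<^sub>C u n) < e" by blast
qed

text \<open>A common frame for an operator and its functional calculus, with coefficients
  \<open>s n\<close> and \<open>f (s n)\<close> over the same singular vectors.\<close>

locale orthonormal_expansion =
  fixes a :: "nat \<Rightarrow> complex" and u v :: "nat \<Rightarrow> 'a::complex_hilbert_space" and T :: "'a \<Rightarrow> 'a"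
  assumes u: "orthonormal_family {n. a n \<noteq> 0} u" and v: "orthonormal_family {n. a n \<noteq> 0} v"
    and a: "summable (\<lambda>n. (cmod (a n))\<^sup>2)"
    and T: "\<And>h. (\<lambda>n. (a n * cinner h (v n)) *\<^sub>C u n) sums T h"
begin

lemma expansion_clinear: "clinear T"
  unfolding clinear_iff
proof (intro conjI allI)
  fix x y
  show "T (x + y) = T x + T y"
    using sums_add[OF T T] by (intro sums_unique2[OF T]) (simp add: cinner_add_left distrib_left scaleC_add_left)
next
  fix c x
  show "T (c *\<^sub>C x) = c *\<^sub>C T x"
    using bounded_linear.sums[OF bounded_linear_scaleC_right T, of c]
    by (intro sums_unique2[OF T]) (simp add: scaleC_scaleC cinner_scaleC_left mult_ac)
qed

definition partial :: "nat \<Rightarrow> 'a \<Rightarrow> 'a"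
  where "partial N h = (\<Sum>n<N. (a n * cinner h (v n)) *\<^sub>C u n)"

definition tail :: "nat \<Rightarrow> real"
  where "tail N = (\<Sum>n. (cmod (a n))\<^sup>2) - (\<Sum>n<N. (cmod (a n))\<^sup>2)"

lemma partial_lim: "(\<lambda>N. partial N h) \<longlonglongrightarrow> T h"
  using T by (simp add: partial_def sums_def)

lemma tail_nonneg: "0 \<le> tail N"
  unfolding tail_def using sum_le_suminf[OF a, of "{..<N}"] by simp

lemma tail_lim: "tail \<longlonglongrightarrow> 0"
proof -
  have "(\<lambda>N. (\<Sum>n. (cmod (a n))\<^sup>2) - (\<Sum>n<N. (cmod (a n))\<^sup>2)) \<longlonglongrightarrow>
    (\<Sum>n. (cmod (a n))\<^sup>2) - (\<Sum>n. (cmod (a n))\<^sup>2)"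
    by (intro tendsto_intros summable_LIMSEQ a)
  then show ?thesis by (simp add: tail_def[abs_def])
qed

text \<open>A difference of partial sums is again a finite expansion; its bound survives the limit
  in \<open>K\<close>. It is uniform in \<open>F\<close>, so the test set may later vary with
  \<open>N\<close>.\<close>

lemma sum_norm_remainder_le:
  assumes F: "finite F" "orthonormal_set F"
  shows "(\<Sum>e\<in>F. (norm (T e - partial N e))\<^sup>2) \<le> tail N"
proof -
  have "(\<lambda>K. \<Sum>e\<in>F. (norm (partial K e - partial N e))\<^sup>2) \<longlonglongrightarrow> (\<Sum>e\<in>F. (norm (T e - partial N e))\<^sup>2)"
    by (intro tendsto_intros partial_lim)
  moreover have "(\<Sum>e\<in>F. (norm (partial K e - partial N e))\<^sup>2) \<le> tail N" if "N \<le> K" for K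
  proof -
    have split: "(\<Sum>n<K. g n) - (\<Sum>n<N. g n) = (\<Sum>n=N..<K. g n)" for g :: "nat \<Rightarrow> 'b::ab_group_add"
      using sum_diff_nat_ivl[of 0 N K g] that by (simp add: lessThan_atLeast0)
    have "(\<Sum>e\<in>F. (norm (partial K e - partial N e))\<^sup>2) \<le> (\<Sum>n=N..<K. (cmod (a n))\<^sup>2)"
      unfolding partial_def split by (rule sum_norm_expansion_le[OF u v _ F]) simp
    also have "\<dots> = (\<Sum>n<K. (cmod (a n))\<^sup>2) - (\<Sum>n<N. (cmod (a n))\<^sup>2)" by (rule split[symmetric])
    also have "\<dots> \<le> tail N"
      unfolding tail_def using sum_le_suminf[OF a, of "{..<K}"] by simp
    finally show ?thesis .
  qed
  ultimately show ?thesis by (intro LIMSEQ_le_const2) blast+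
qed

end

section \<open>The finite-dimensional inequality\<close>

text \<open>Only the right vectors are paired with \<open>e\<close>, so it is enough that
  \<open>G\<close> spans these: Parseval then turns the two square terms and the cross term into
  exact sums.\<close>

lemma sum_norm_expansion_diff:
  fixes u v :: "'i \<Rightarrow> 'a::complex_hilbert_space" and x y :: "'j \<Rightarrow> 'a"
  assumes u: "orthonormal_family S u" and v: "orthonormal_family S v"
    and x: "orthonormal_family T x" and y: "orthonormal_family T y"
    and fin: "finite S" "finite T"
    and Gv: "\<forall>n\<in>S. v n = (\<Sum>e\<in>G. cinner (v n) e *\<^sub>C e)"
    and Gy: "\<forall>m\<in>T. y m = (\<Sum>e\<in>G. cinner (y m) e *\<^sub>C e)"
  shows "(\<Sum>e\<in>G. (norm ((\<Sum>n\<in>S. (\<alpha> n * cinner e (v n)) *\<^sub>C u n) - (\<Sum>m\<in>T. (\<beta> m * cinner e (y m)) *\<^sub>C x m)))\<^sup>2)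
    = (\<Sum>n\<in>S. (cmod (\<alpha> n))\<^sup>2) + (\<Sum>m\<in>T. (cmod (\<beta> m))\<^sup>2)
      - 2 * Re (\<Sum>n\<in>S. \<Sum>m\<in>T. \<alpha> n * cnj (\<beta> m) * (cinner (u n) (x m) * cinner (y m) (v n)))"
proof -
  have parseval: "(\<Sum>e\<in>G. (cmod (cinner e w))\<^sup>2) = 1"
    if "w = (\<Sum>e\<in>G. cinner w e *\<^sub>C e)" "norm w = 1" for w
  proof -
    have "complex_of_real (\<Sum>e\<in>G. (cmod (cinner e w))\<^sup>2) = (\<Sum>e\<in>G. cinner w e * cinner e w)"
      using cinner_commute[of w] by (simp add: complex_norm_square mult.commute del: of_real_power)
    also have "\<dots> = 1"
      using parseval_span[OF that(1), of w] that(2) by (simp add: cinner_self)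
    finally show ?thesis by (simp only: of_real_eq_1_iff)
  qed
  have sq: "(\<Sum>e\<in>G. (norm (\<Sum>n\<in>S. (\<alpha> n * cinner e (v n)) *\<^sub>C u n))\<^sup>2) = (\<Sum>n\<in>S. (cmod (\<alpha> n))\<^sup>2)"
    if u: "orthonormal_family S u" and v: "orthonormal_family S v" and fin: "finite S"
      and Gv: "\<forall>n\<in>S. v n = (\<Sum>e\<in>G. cinner (v n) e *\<^sub>C e)"
    for S :: "'k set" and \<alpha> and u v :: "'k \<Rightarrow> 'a"
  proof -
    have "(\<Sum>e\<in>G. (norm (\<Sum>n\<in>S. (\<alpha> n * cinner e (v n)) *\<^sub>C u n))\<^sup>2)
        = (\<Sum>e\<in>G. \<Sum>n\<in>S. (cmod (\<alpha> n))\<^sup>2 * (cmod (cinner e (v n)))\<^sup>2)"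
      using norm_sum_orthonormal[OF u fin] by (intro sum.cong refl) (simp add: norm_mult power_mult_distrib)
    also have "\<dots> = (\<Sum>n\<in>S. (cmod (\<alpha> n))\<^sup>2 * (\<Sum>e\<in>G. (cmod (cinner e (v n)))\<^sup>2))"
      by (subst sum.swap) (simp add: sum_distrib_left)
    also have "\<dots> = (\<Sum>n\<in>S. (cmod (\<alpha> n))\<^sup>2)"
      using parseval[OF bspec[OF Gv] orthonormal_family_norm[OF v]] by (intro sum.cong refl) simp
    finally show ?thesis .
  qed
  \<comment> \<open>The sum over \<open>e\<close> is moved innermost, where it collapses to
    \<open>cinner (y m) (v n)\<close>.\<close>
  have "(\<Sum>e\<in>G. cinner (\<Sum>n\<in>S. (\<alpha> n * cinner e (v n)) *\<^sub>C u n) (\<Sum>m\<in>T. (\<beta> m * cinner e (y m)) *\<^sub>C x m))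
      = (\<Sum>e\<in>G. \<Sum>n\<in>S. \<Sum>m\<in>T. \<alpha> n * cnj (\<beta> m) * cinner (u n) (x m) * (cinner (y m) e * cinner e (v n)))"
    using cinner_commute[of "y _"]
    by (simp add: cinner_sum_left cinner_sum_right cinner_scaleC_left cinner_scaleC_right
        sum_distrib_left mult_ac)
      (intro sum.cong refl sum.swap)
  also have "\<dots> = (\<Sum>n\<in>S. \<Sum>m\<in>T. \<Sum>e\<in>G. \<alpha> n * cnj (\<beta> m) * cinner (u n) (x m) * (cinner (y m) e * cinner e (v n)))"
    by (subst sum.swap) (intro sum.cong refl sum.swap)
  also have "\<dots> = (\<Sum>n\<in>S. \<Sum>m\<in>T. \<alpha> n * cnj (\<beta> m) * (cinner (u n) (x m) * cinner (y m) (v n)))"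
    using parseval_span[OF bspec[OF Gy]] by (intro sum.cong refl) (simp add: sum_distrib_left mult.assoc)
  finally have cross: "(\<Sum>e\<in>G. cinner (\<Sum>n\<in>S. (\<alpha> n * cinner e (v n)) *\<^sub>C u n) (\<Sum>m\<in>T. (\<beta> m * cinner e (y m)) *\<^sub>C x m))
      = (\<Sum>n\<in>S. \<Sum>m\<in>T. \<alpha> n * cnj (\<beta> m) * (cinner (u n) (x m) * cinner (y m) (v n)))" .
  show ?thesis
    unfolding norm_diff_sq cross[symmetric] Re_sum
    by (simp add: sum.distrib sum_subtractf sum_distrib_left sq[OF u v fin(1) Gv] sq[OF x y fin(2) Gy])
qed

text \<open>
  The phase \<open>c\<close> in the Lipschitz condition is chosen to align the cross term.
\<close>

lemma Lip_C_pointwise: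
  fixes f :: "real \<Rightarrow> complex"
  assumes Lip: "\<forall>x\<ge>0. \<forall>y\<ge>0. \<forall>c. cmod c = 1 \<longrightarrow>
      cmod (f x - c * f y) \<le> L * cmod (complex_of_real x - c * complex_of_real y)"
    and "0 \<le> x" "0 \<le> y"
  shows "2 * cmod (complex_of_real (L\<^sup>2 * x * y) - f x * cnj (f y))
    \<le> (L\<^sup>2 * x\<^sup>2 - (cmod (f x))\<^sup>2) + (L\<^sup>2 * y\<^sup>2 - (cmod (f y))\<^sup>2)"
proof -
  define k where "k = complex_of_real (L\<^sup>2 * x * y) - f x * cnj (f y)"
  obtain c where c: "cmod c = 1" "cnj c * k = complex_of_real (cmod k)"
  proof (cases "k = 0")
    case False
    have "cnj (k / complex_of_real (cmod k)) * k = complex_of_real (cmod k)"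
      using False complex_norm_square[of k] by (simp add: power2_eq_square divide_simps mult.commute)
    with False show ?thesis by (intro that[of "k / complex_of_real (cmod k)"]) (auto simp: norm_divide)
  qed (use that[of 1] in auto)
  have expand: "(cmod (p - c * q))\<^sup>2 = (cmod p)\<^sup>2 + (cmod q)\<^sup>2 - 2 * Re (cnj c * (p * cnj q))" for p q
    using norm_diff_sq[of p "c * q"] c(1) by (simp add: cinner_complex_def norm_mult mult_ac)
  have "(cmod (f x - c * f y))\<^sup>2 \<le> (L * cmod (complex_of_real x - c * complex_of_real y))\<^sup>2"
    using Lip assms(2,3) c(1) by (intro power_mono) auto
  then have "(cmod (f x))\<^sup>2 + (cmod (f y))\<^sup>2 - 2 * Re (cnj c * (f x * cnj (f y)))
      \<le> L\<^sup>2 * (x\<^sup>2 + y\<^sup>2 - 2 * Re (cnj c * (complex_of_real x * complex_of_real y)))"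
    unfolding power_mult_distrib expand by simp
  moreover have "L\<^sup>2 * Re (cnj c * (complex_of_real x * complex_of_real y)) - Re (cnj c * (f x * cnj (f y))) = cmod k"
  proof -
    have "L\<^sup>2 * Re (cnj c * (complex_of_real x * complex_of_real y)) - Re (cnj c * (f x * cnj (f y))) = Re (cnj c * k)"
      by (simp add: k_def algebra_simps)
    then show ?thesis by (simp add: c(2))
  qed
  ultimately show ?thesis
    unfolding k_def by (simp add: algebra_simps)
qed

text \<open>The weights \<open>g i\<close> meet only row sums and the weights \<open>h j\<close>
  only column sums.\<close>

lemma weighted_double_sum_le:
  fixes a :: "'i \<Rightarrow> 'j \<Rightarrow> real"
  assumes "\<And>i. i \<in> S \<Longrightarrow> (\<Sum>j\<in>T. a i j) \<le> 1" "\<And>j. j \<in> T \<Longrightarrow> (\<Sum>i\<in>S. a i j) \<le> 1"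
    and g: "\<And>i. i \<in> S \<Longrightarrow> 0 \<le> g i" and h: "\<And>j. j \<in> T \<Longrightarrow> 0 \<le> h j"
  shows "(\<Sum>i\<in>S. \<Sum>j\<in>T. (g i + h j) * a i j) \<le> sum g S + sum h T"
proof -
  have "(\<Sum>i\<in>S. \<Sum>j\<in>T. (g i + h j) * a i j) = (\<Sum>i\<in>S. g i * (\<Sum>j\<in>T. a i j)) + (\<Sum>i\<in>S. \<Sum>j\<in>T. h j * a i j)"
    by (simp add: distrib_right sum.distrib sum_distrib_left)
  also have "(\<Sum>i\<in>S. \<Sum>j\<in>T. h j * a i j) = (\<Sum>j\<in>T. h j * (\<Sum>i\<in>S. a i j))"
    by (subst sum.swap) (simp add: sum_distrib_left)
  also have "(\<Sum>i\<in>S. g i * (\<Sum>j\<in>T. a i j)) \<le> sum g S"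
    using assms by (intro sum_mono mult_left_le) auto
  also have "(\<Sum>j\<in>T. h j * (\<Sum>i\<in>S. a i j)) \<le> sum h T"
    using assms by (intro sum_mono mult_left_le) auto
  finally show ?thesis by simp
qed

lemma Lip_C_finite_expansions:
  fixes u v :: "'i \<Rightarrow> 'a::complex_hilbert_space" and x y :: "'j \<Rightarrow> 'a"
  assumes u: "orthonormal_family S u" and v: "orthonormal_family S v"
    and x: "orthonormal_family T x" and y: "orthonormal_family T y"
    and fin: "finite S" "finite T"
    and Gv: "\<forall>n\<in>S. v n = (\<Sum>e\<in>G. cinner (v n) e *\<^sub>C e)"
    and Gy: "\<forall>m\<in>T. y m = (\<Sum>e\<in>G. cinner (y m) e *\<^sub>C e)"
    and s: "\<And>n. 0 \<le> s n" and t: "\<And>m. 0 \<le> t m" and L: "0 \<le> L"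
    and Lip: "\<forall>x\<ge>0. \<forall>y\<ge>0. \<forall>c. cmod c = 1 \<longrightarrow>
      cmod (f x - c * f y) \<le> L * cmod (complex_of_real x - c * complex_of_real y)"
  shows "(\<Sum>e\<in>G. (norm ((\<Sum>n\<in>S. (f (s n) * cinner e (v n)) *\<^sub>C u n) - (\<Sum>m\<in>T. (f (t m) * cinner e (y m)) *\<^sub>C x m)))\<^sup>2)
    \<le> L\<^sup>2 * (\<Sum>e\<in>G. (norm ((\<Sum>n\<in>S. (complex_of_real (s n) * cinner e (v n)) *\<^sub>C u n)
          - (\<Sum>m\<in>T. (complex_of_real (t m) * cinner e (y m)) *\<^sub>C x m)))\<^sup>2)"
proof -
  define g where "g r = L\<^sup>2 * r\<^sup>2 - (cmod (f r))\<^sup>2" for r :: real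
  define k where "k p r = complex_of_real (L\<^sup>2 * p * r) - f p * cnj (f r)" for p r
  define a where "a n m = cinner (u n) (x m) * cinner (y m) (v n)" for n m
  have k: "2 * cmod (k p r) \<le> g p + g r" if "0 \<le> p" "0 \<le> r" for p r
    unfolding k_def g_def by (rule Lip_C_pointwise[OF Lip that])
  \<comment> \<open>Equal arguments in \<open>k\<close> give
    \<open>2 * cmod (k r r) \<le> 2 * g r\<close>.\<close>
  have g: "0 \<le> g r" if "0 \<le> r" for r
    using k[OF that that] norm_ge_zero[of "k r r"] by linarith
  \<comment> \<open>The arithmetic-geometric mean inequality separates the left vectors from the
    right ones, so each row or column sum splits into two Bessel sums.\<close>
  have ca: "cmod (a n m) \<le> ((cmod (cinner (u n) (x m)))\<^sup>2 + (cmod (cinner (y m) (v n)))\<^sup>2) / 2" for n m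
    using sum_squares_bound[of "cmod (cinner (u n) (x m))" "cmod (cinner (y m) (v n))"]
    by (simp add: a_def norm_mult)
  have row: "(\<Sum>m\<in>T. cmod (a n m)) \<le> 1" if "n \<in> S" for n
  proof -
    have "(\<Sum>m\<in>T. cmod (a n m)) \<le> ((\<Sum>m\<in>T. (cmod (cinner (u n) (x m)))\<^sup>2) + (\<Sum>m\<in>T. (cmod (cinner (v n) (y m)))\<^sup>2)) / 2"
      unfolding sum.distrib[symmetric] sum_divide_distrib
      using ca by (intro sum_mono) (simp add: norm_cinner_commute[of "v n"])
    moreover have "(\<Sum>m\<in>T. (cmod (cinner (u n) (x m)))\<^sup>2) \<le> 1" "(\<Sum>m\<in>T. (cmod (cinner (v n) (y m)))\<^sup>2) \<le> 1"
      using bessel[OF x fin(2), of "u n"] bessel[OF y fin(2), of "v n"]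
        orthonormal_family_norm[OF u that] orthonormal_family_norm[OF v that] by auto
    ultimately show ?thesis by auto
  qed
  have col: "(\<Sum>n\<in>S. cmod (a n m)) \<le> 1" if "m \<in> T" for m
  proof -
    have "(\<Sum>n\<in>S. cmod (a n m)) \<le> ((\<Sum>n\<in>S. (cmod (cinner (x m) (u n)))\<^sup>2) + (\<Sum>n\<in>S. (cmod (cinner (y m) (v n)))\<^sup>2)) / 2"
      unfolding sum.distrib[symmetric] sum_divide_distrib
      using ca by (intro sum_mono) (simp add: norm_cinner_commute[of "x m"])
    moreover have "(\<Sum>n\<in>S. (cmod (cinner (x m) (u n)))\<^sup>2) \<le> 1" "(\<Sum>n\<in>S. (cmod (cinner (y m) (v n)))\<^sup>2) \<le> 1"
      using bessel[OF u fin(1), of "x m"] bessel[OF v fin(1), of "y m"]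
        orthonormal_family_norm[OF x that] orthonormal_family_norm[OF y that] by auto
    ultimately show ?thesis by auto
  qed
  have "2 * Re (\<Sum>n\<in>S. \<Sum>m\<in>T. k (s n) (t m) * a n m) \<le> (\<Sum>n\<in>S. \<Sum>m\<in>T. (g (s n) + g (t m)) * cmod (a n m))"
    unfolding Re_sum sum_distrib_left
  proof (intro sum_mono)
    fix n m
    have "2 * Re (k (s n) (t m) * a n m) \<le> 2 * cmod (k (s n) (t m)) * cmod (a n m)"
      using complex_Re_le_cmod[of "k (s n) (t m) * a n m"] by (simp add: norm_mult)
    also have "\<dots> \<le> (g (s n) + g (t m)) * cmod (a n m)"
      using k[OF s t] by (intro mult_right_mono) auto
    finally show "2 * Re (k (s n) (t m) * a n m) \<le> (g (s n) + g (t m)) * cmod (a n m)" .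
  qed
  also have "\<dots> \<le> (\<Sum>n\<in>S. g (s n)) + (\<Sum>m\<in>T. g (t m))"
    by (rule weighted_double_sum_le) (use row col g s t in auto)
  also have "Re (\<Sum>n\<in>S. \<Sum>m\<in>T. k (s n) (t m) * a n m)
    = L\<^sup>2 * Re (\<Sum>n\<in>S. \<Sum>m\<in>T. complex_of_real (s n) * cnj (complex_of_real (t m)) * a n m)
      - Re (\<Sum>n\<in>S. \<Sum>m\<in>T. f (s n) * cnj (f (t m)) * a n m)"
    unfolding Re_sum sum_distrib_left sum_subtractf[symmetric]
    by (intro sum.cong refl) (simp add: k_def algebra_simps)
  finally have le: "2 * (L\<^sup>2 * Re (\<Sum>n\<in>S. \<Sum>m\<in>T. complex_of_real (s n) * cnj (complex_of_real (t m)) * a n m)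
      - Re (\<Sum>n\<in>S. \<Sum>m\<in>T. f (s n) * cnj (f (t m)) * a n m))
    \<le> (\<Sum>n\<in>S. g (s n)) + (\<Sum>m\<in>T. g (t m))" .
  have sum_g: "(\<Sum>n\<in>N. g (r n)) = L\<^sup>2 * (\<Sum>n\<in>N. (cmod (complex_of_real (r n)))\<^sup>2) - (\<Sum>n\<in>N. (cmod (f (r n)))\<^sup>2)"
    for N :: "'k set" and r
    by (simp add: g_def sum_subtractf sum_distrib_left)
  note E = sum_norm_expansion_diff[OF u v x y fin Gv Gy, folded a_def]
  show ?thesis
    using le unfolding E[where \<alpha> = "\<lambda>n. f (s n)" and \<beta> = "\<lambda>m. f (t m)"]
      E[where \<alpha> = "\<lambda>n. complex_of_real (s n)" and \<beta> = "\<lambda>m. complex_of_real (t m)"] sum_g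
    by (simp only: right_diff_distrib distrib_left)
qed

section \<open>The estimate for the functional calculus\<close>

lemma (in orthonormal_expansion) expansion_hilbert_schmidt: "T \<in> hilbert_schmidt"
proof (rule hilbert_schmidtI(1)[OF expansion_clinear])
  show "0 \<le> sqrt (tail 0)" by (simp add: tail_nonneg)
  show "(\<Sum>e\<in>F. (norm (T e))\<^sup>2) \<le> (sqrt (tail 0))\<^sup>2" if "finite F" "orthonormal_set F" for F
    using sum_norm_remainder_le[OF that, of 0] tail_nonneg by (simp add: partial_def)
qed

text \<open>The choice inside \<open>sv_calculus\<close> does not mention \<open>f\<close>, so one
  pair \<open>u\<close>, \<open>v\<close> serves every function at once.\<close>

lemma sv_calculus_eq_suminf:
  assumes "compact_operator A"
  obtains u v where "is_svd A (singular_value A) u v"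
    and "\<And>f. sv_calculus f A = (\<lambda>h. \<Sum>n. (f (singular_value A n) * cinner h (v n)) *\<^sub>C u n)"
proof -
  define uv where "uv = (SOME (u, v). is_svd A (singular_value A) u v)"
  have "\<exists>uv. case uv of (u, v) \<Rightarrow> is_svd A (singular_value A) u v"
    using compact_operator_svd[OF assms] by auto
  then have "case uv of (u, v) \<Rightarrow> is_svd A (singular_value A) u v"
    unfolding uv_def by (rule someI_ex)
  then show thesis
    by (intro that[of "fst uv" "snd uv"])
      (auto simp: sv_calculus_def uv_def[symmetric] split_beta)
qed

lemma sv_calculus_expansion:
  fixes A :: "'a::complex_hilbert_space \<Rightarrow> 'a"
  assumes A: "A \<in> hilbert_schmidt" and f0: "f 0 = 0" and f: "\<And>x. 0 \<le> x \<Longrightarrow> cmod (f x) \<le> K * x"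
  obtains s u v where "\<And>n. 0 \<le> s n"
    "orthonormal_family {n. s n \<noteq> 0} u" "orthonormal_family {n. s n \<noteq> 0} v"
    "orthonormal_expansion (\<lambda>n. complex_of_real (s n)) u v A"
    "orthonormal_expansion (\<lambda>n. f (s n)) u v (sv_calculus f A)"
proof -
  have cpt: "compact_operator A" and sm: "summable (\<lambda>n. (singular_value A n)\<^sup>2)"
    using A by (auto simp: hilbert_schmidt_def)
  obtain u v where svd: "is_svd A (singular_value A) u v"
    and eq: "\<And>f. sv_calculus f A = (\<lambda>h. \<Sum>n. (f (singular_value A n) * cinner h (v n)) *\<^sub>C u n)"
    using sv_calculus_eq_suminf[OF cpt] by blast
  note S = is_svdD[OF svd]
  \<comment> \<open>Because \<open>f 0 = 0\<close>, the coefficients \<open>f (s n)\<close> vanish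
    wherever the singular vectors are unconstrained.\<close>
  have sub: "{n. f (singular_value A n) \<noteq> 0} \<subseteq> {n. singular_value A n \<noteq> 0}" using f0 by auto
  note u = orthonormal_family_subset[OF S(4) sub] and v = orthonormal_family_subset[OF S(5) sub]
  have "norm ((cmod (f (singular_value A n)))\<^sup>2) \<le> K\<^sup>2 * (singular_value A n)\<^sup>2" for n
    using power_mono[OF f[OF S(3)] norm_ge_zero, of n 2] by (simp add: power_mult_distrib)
  then have sf: "summable (\<lambda>n. (cmod (f (singular_value A n)))\<^sup>2)"
    by (intro summable_comparison_test'[OF summable_mult[OF sm]])
  show thesis
  proof (rule that[OF S(3,4,5)])
    show "orthonormal_expansion (\<lambda>n. complex_of_real (singular_value A n)) u v A"
      using S sm by unfold_locales simp_all
    show "orthonormal_expansion (\<lambda>n. f (singular_value A n)) u v (sv_calculus f A)"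
      using u v sf summable_sums[OF summable_orthonormal_expansion[OF u v sf]]
      by unfold_locales (simp_all add: eq)
  qed
qed

text \<open>
  The finite-dimensional inequality is applied to truncations of both expansions, on a finite
  orthonormal set that contains the test set \<open>F\<close> and spans the right singular vectors involved.
\<close>

lemma sv_calculus_Lip_C:
  fixes f :: "real \<Rightarrow> complex" and A B :: "'a::complex_hilbert_space \<Rightarrow> 'a"
  assumes A: "A \<in> hilbert_schmidt" and B: "B \<in> hilbert_schmidt"
    and f0: "f 0 = 0" and L: "0 \<le> L"
    and Lip: "\<forall>x\<ge>0. \<forall>y\<ge>0. \<forall>c. cmod c = 1 \<longrightarrow>
      cmod (f x - c * f y) \<le> L * cmod (complex_of_real x - c * complex_of_real y)"
  shows "sv_calculus f A \<in> hilbert_schmidt" "sv_calculus f B \<in> hilbert_schmidt"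
    "hs_norm (\<lambda>h. sv_calculus f A h - sv_calculus f B h) \<le> L * hs_norm (\<lambda>h. A h - B h)"
proof -
  have growth: "cmod (f x) \<le> L * x" if "0 \<le> x" for x
    using Lip[rule_format, of x 0 1] that f0 by simp
  obtain s u v where s: "\<And>n. 0 \<le> s n"
    and u: "orthonormal_family {n. s n \<noteq> 0} u" and v: "orthonormal_family {n. s n \<noteq> 0} v"
    and EA: "orthonormal_expansion (\<lambda>n. complex_of_real (s n)) u v A"
    and EfA: "orthonormal_expansion (\<lambda>n. f (s n)) u v (sv_calculus f A)"
    using sv_calculus_expansion[where f = f, OF A f0 growth] by metis
  obtain t x y where t: "\<And>n. 0 \<le> t n"
    and x: "orthonormal_family {n. t n \<noteq> 0} x" and y: "orthonormal_family {n. t n \<noteq> 0} y"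
    and EB: "orthonormal_expansion (\<lambda>n. complex_of_real (t n)) x y B"
    and EfB: "orthonormal_expansion (\<lambda>n. f (t n)) x y (sv_calculus f B)"
    using sv_calculus_expansion[where f = f, OF B f0 growth] by metis
  interpret A: orthonormal_expansion "\<lambda>n. complex_of_real (s n)" u v A by (rule EA)
  interpret B: orthonormal_expansion "\<lambda>n. complex_of_real (t n)" x y B by (rule EB)
  interpret fA: orthonormal_expansion "\<lambda>n. f (s n)" u v "sv_calculus f A" by (rule EfA)
  interpret fB: orthonormal_expansion "\<lambda>n. f (t n)" x y "sv_calculus f B" by (rule EfB)
  show fA_hs: "sv_calculus f A \<in> hilbert_schmidt" and fB_hs: "sv_calculus f B \<in> hilbert_schmidt"
    by (rule fA.expansion_hilbert_schmidt fB.expansion_hilbert_schmidt)+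
  define D where "D = hs_norm (\<lambda>h. A h - B h)"
  have AB: "(\<lambda>h. A h - B h) \<in> hilbert_schmidt" by (rule hilbert_schmidt_diff[OF A B])
  have D: "0 \<le> D" unfolding D_def by (rule hs_norm_nonneg[OF AB])
  \<comment> \<open>The set \<open>G\<close> built below depends on \<open>N\<close>, but the
    resulting bound involves only \<open>D\<close> and the tails, which tend to 0.\<close>
  have trunc: "sqrt (\<Sum>e\<in>F. (norm (fA.partial N e - fB.partial N e))\<^sup>2)
      \<le> L * (D + (sqrt (A.tail N) + sqrt (B.tail N)))"
    if F: "finite F" "orthonormal_set F" for F N
  proof -
    define S where "S = {..<N} \<inter> {n. s n \<noteq> 0}"
    define T where "T = {..<N} \<inter> {n. t n \<noteq> 0}"
    have fin: "finite S" "finite T" by (auto simp: S_def T_def)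
    have uS: "orthonormal_family S u" and vS: "orthonormal_family S v"
      using u v by (auto simp: S_def intro: orthonormal_family_subset)
    have xT: "orthonormal_family T x" and yT: "orthonormal_family T y"
      using x y by (auto simp: T_def intro: orthonormal_family_subset)
    have "finite (v ` S \<union> y ` T)" using fin by simp
    from orthonormal_set_extend[OF this F]
    obtain G where G: "finite G" "F \<subseteq> G" "orthonormal_set G"
      and span: "\<forall>z\<in>v ` S \<union> y ` T. z = (\<Sum>e\<in>G. cinner z e *\<^sub>C e)" by blast
    have GvS: "\<forall>n\<in>S. v n = (\<Sum>e\<in>G. cinner (v n) e *\<^sub>C e)"
      and GyT: "\<forall>m\<in>T. y m = (\<Sum>e\<in>G. cinner (y m) e *\<^sub>C e)"
      using span by blast+
    have pA: "(\<Sum>n\<in>S. (complex_of_real (s n) * cinner e (v n)) *\<^sub>C u n) = A.partial N e"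
      and pfA: "(\<Sum>n\<in>S. (f (s n) * cinner e (v n)) *\<^sub>C u n) = fA.partial N e"
      and pB: "(\<Sum>n\<in>T. (complex_of_real (t n) * cinner e (y n)) *\<^sub>C x n) = B.partial N e"
      and pfB: "(\<Sum>n\<in>T. (f (t n) * cinner e (y n)) *\<^sub>C x n) = fB.partial N e" for e
      unfolding A.partial_def fA.partial_def B.partial_def fB.partial_def
      by (rule sum.mono_neutral_left; auto simp: S_def T_def f0)+
    have "(\<Sum>e\<in>F. (norm (fA.partial N e - fB.partial N e))\<^sup>2) \<le> (\<Sum>e\<in>G. (norm (fA.partial N e - fB.partial N e))\<^sup>2)"
      by (rule sum_mono2[OF G(1,2)]) simp
    also have "\<dots> \<le> L\<^sup>2 * (\<Sum>e\<in>G. (norm (A.partial N e - B.partial N e))\<^sup>2)"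
      using Lip_C_finite_expansions[where f = f and s = s and t = t, OF uS vS xT yT fin GvS GyT s t L Lip]
      unfolding pA pB pfA pfB .
    finally have "sqrt (\<Sum>e\<in>F. (norm (fA.partial N e - fB.partial N e))\<^sup>2)
      \<le> sqrt (L\<^sup>2 * (\<Sum>e\<in>G. (norm (A.partial N e - B.partial N e))\<^sup>2))"
      by (rule real_sqrt_le_mono)
    also have "\<dots> = L * sqrt (\<Sum>e\<in>G. (norm (A.partial N e - B.partial N e))\<^sup>2)"
      using L by (simp only: real_sqrt_mult real_sqrt_abs abs_of_nonneg)
    finally have "sqrt (\<Sum>e\<in>F. (norm (fA.partial N e - fB.partial N e))\<^sup>2)
      \<le> L * sqrt (\<Sum>e\<in>G. (norm (A.partial N e - B.partial N e))\<^sup>2)" .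
    \<comment> \<open>The truncated difference is the full difference \<open>A - B\<close> corrected
      by the two remainders.\<close>
    also have "sqrt (\<Sum>e\<in>G. (norm (A.partial N e - B.partial N e))\<^sup>2)
      = sqrt (\<Sum>e\<in>G. (norm ((A e - B e) + (- (A e - A.partial N e) + (B e - B.partial N e))))\<^sup>2)"
      by (simp add: algebra_simps)
    also have "\<dots> \<le> sqrt (\<Sum>e\<in>G. (norm (A e - B e))\<^sup>2)
      + (sqrt (\<Sum>e\<in>G. (norm (- (A e - A.partial N e)))\<^sup>2) + sqrt (\<Sum>e\<in>G. (norm (B e - B.partial N e))\<^sup>2))"
      by (intro order_trans[OF sqrt_sum_norm_add_le] add_left_mono sqrt_sum_norm_add_le)
    also have "\<dots> \<le> D + (sqrt (A.tail N) + sqrt (B.tail N))"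
    proof (intro add_mono)
      show "sqrt (\<Sum>e\<in>G. (norm (A e - B e))\<^sup>2) \<le> D"
        using hilbert_schmidt_sum_le[OF AB G(1,3)] D by (intro real_le_lsqrt) (auto simp: D_def)
    qed (simp_all only: norm_minus_cancel real_sqrt_le_iff A.sum_norm_remainder_le[OF G(1,3)]
        B.sum_norm_remainder_le[OF G(1,3)])
    finally show ?thesis using L by (simp add: mult_left_mono)
  qed
  have "(\<Sum>e\<in>F. (norm (sv_calculus f A e - sv_calculus f B e))\<^sup>2) \<le> (L * D)\<^sup>2"
    if F: "finite F" "orthonormal_set F" for F
  proof (rule sqrt_le_D, rule LIMSEQ_le)
    show "(\<lambda>N. sqrt (\<Sum>e\<in>F. (norm (fA.partial N e - fB.partial N e))\<^sup>2)) \<longlonglongrightarrow>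
        sqrt (\<Sum>e\<in>F. (norm (sv_calculus f A e - sv_calculus f B e))\<^sup>2)"
      by (intro tendsto_intros fA.partial_lim fB.partial_lim)
    have "(\<lambda>N. L * (D + (sqrt (A.tail N) + sqrt (B.tail N)))) \<longlonglongrightarrow> L * (D + (sqrt 0 + sqrt 0))"
      by (intro tendsto_intros A.tail_lim B.tail_lim)
    then show "(\<lambda>N. L * (D + (sqrt (A.tail N) + sqrt (B.tail N)))) \<longlonglongrightarrow> L * D" by simp
  qed (use trunc[OF F] in blast)
  then show "hs_norm (\<lambda>h. sv_calculus f A h - sv_calculus f B h) \<le> L * hs_norm (\<lambda>h. A h - B h)"
    unfolding D_def[symmetric]
    using L D hilbert_schmidt_clinear[OF hilbert_schmidt_diff[OF fA_hs fB_hs]]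
    by (intro hilbert_schmidtI(2)) auto
qed

section \<open>Optimality\<close>

text \<open>The complex factor carries both the singular value \<open>cmod a\<close> and a phase, so
  the two operators needed for optimality are of the same form.\<close>

definition rank_one :: "complex \<Rightarrow> 'a::complex_hilbert_space \<Rightarrow> 'a \<Rightarrow> 'a"
  where "rank_one a e h = (a * cinner h e) *\<^sub>C e"

context
  fixes e :: "'a::complex_hilbert_space"
  assumes e: "norm e = 1"
begin

lemma rank_one_hilbert_schmidt: "rank_one a e \<in> hilbert_schmidt"
proof (rule hilbert_schmidtI(1))
  show "clinear (rank_one a e)"
    by (simp add: clinear_iff rank_one_def cinner_add_left cinner_scaleC_left distrib_left
        scaleC_add_left scaleC_scaleC mult_ac)
  show "(\<Sum>g\<in>F. (norm (rank_one a e g))\<^sup>2) \<le> (cmod a)\<^sup>2" if F: "finite F" "orthonormal_set F" for F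
  proof -
    have "(\<Sum>g\<in>F. (norm (rank_one a e g))\<^sup>2) = (cmod a)\<^sup>2 * (\<Sum>g\<in>F. (cmod (cinner e g))\<^sup>2)"
      by (simp add: rank_one_def norm_scaleC norm_mult power_mult_distrib e sum_distrib_left
          norm_cinner_commute[of e])
    also have "\<dots> \<le> (cmod a)\<^sup>2"
      using bessel[OF F(2,1), of e] e by (intro mult_left_le) auto
    finally show ?thesis .
  qed
qed simp

text \<open>The phase is put into the left vector. For \<open>a = 0\<close> that vector is zero, but
  no index then has a positive singular value.\<close>

lemma rank_one_svd:
  "is_svd (rank_one a e) (\<lambda>n. if n = 0 then cmod a else 0) (\<lambda>n. sgn a *\<^sub>C e) (\<lambda>n. e)"
  unfolding is_svd_def
proof (intro conjI allI)
  let ?s = "\<lambda>n::nat. if n = 0 then cmod a else 0"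
  show "decseq ?s" by (auto simp: decseq_def)
  have "(\<lambda>n. ?s (Suc n)) \<longlonglongrightarrow> 0" by simp
  then show "?s \<longlonglongrightarrow> 0" by (rule LIMSEQ_imp_Suc)
  show "orthonormal_on {n. 0 < ?s n} (\<lambda>n. sgn a *\<^sub>C e)"
    by (auto simp: orthonormal_on_def cinner_self norm_scaleC norm_sgn e split: if_splits)
  show "orthonormal_on {n. 0 < ?s n} (\<lambda>n. e)"
    by (auto simp: orthonormal_on_def cinner_self e split: if_splits)
  fix h
  have "complex_of_real (cmod a) * sgn a = a" by (simp add: sgn_eq)
  then have "(complex_of_real (cmod a) * cinner h e) *\<^sub>C sgn a *\<^sub>C e = rank_one a e h"
    by (metis (no_types) mult.assoc mult.commute rank_one_def scaleC_scaleC)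
  then have "(complex_of_real (?s n) * cinner h e) *\<^sub>C sgn a *\<^sub>C e
      = (if n = 0 then rank_one a e h else 0)" for n
    by simp
  then show "(\<lambda>n. (complex_of_real (?s n) * cinner h e) *\<^sub>C sgn a *\<^sub>C e) sums rank_one a e h"
    using sums_single[of 0 "\<lambda>_. rank_one a e h"] by presburger
qed

lemma rank_one_hs_norm: "hs_norm (rank_one a e) = cmod a"
proof -
  have "(\<lambda>n. (singular_value (rank_one a e) n)\<^sup>2) = (\<lambda>n. if n = 0 then (cmod a)\<^sup>2 else 0)"
    by (auto simp: is_svd_singular_value[OF rank_one_svd])
  then show ?thesis
    using sums_unique[OF sums_single[of 0 "\<lambda>_. (cmod a)\<^sup>2"]] by (simp add: hs_norm_def)
qed

text \<open>The decomposition chosen by \<open>sv_calculus\<close> may differ from the one in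
  \<open>rank_one_svd\<close>. In it, both the operator and its functional calculus reduce to the
  term with \<open>u 0\<close> and \<open>v 0\<close>, so they are proportional with ratio
  \<open>f (cmod a)\<close> over \<open>cmod a\<close>.\<close>

lemma rank_one_sv_calculus:
  assumes f0: "f 0 = 0"
  shows "sv_calculus f (rank_one a e) = rank_one (f (cmod a) * sgn a) e"
proof
  fix h
  note s = is_svd_singular_value[OF rank_one_svd, of a]
  have "compact_operator (rank_one a e)"
    using rank_one_hilbert_schmidt[of a] by (simp add: hilbert_schmidt_def)
  then obtain u v where svd: "is_svd (rank_one a e) (\<lambda>n. if n = 0 then cmod a else 0) u v"
    and eq: "sv_calculus f (rank_one a e) h = (\<Sum>n. (f (if n = 0 then cmod a else 0) * cinner h (v n)) *\<^sub>C u n)"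
    by (rule sv_calculus_eq_suminf) (simp add: s)
  have single: "(\<lambda>n. (g (if n = 0 then cmod a else 0) * cinner h (v n)) *\<^sub>C u n) sums
      ((g (cmod a) * cinner h (v 0)) *\<^sub>C u 0)" if "g 0 = 0" for g :: "real \<Rightarrow> complex"
  proof -
    have "(\<lambda>n. (g (if n = 0 then cmod a else 0) * cinner h (v n)) *\<^sub>C u n)
      = (\<lambda>n. if n = 0 then (g (cmod a) * cinner h (v 0)) *\<^sub>C u 0 else 0)"
      using that by auto
    then show ?thesis using sums_single[of 0 "\<lambda>_. (g (cmod a) * cinner h (v 0)) *\<^sub>C u 0"] by simp
  qed
  have 1: "sv_calculus f (rank_one a e) h = (f (cmod a) * cinner h (v 0)) *\<^sub>C u 0"
    unfolding eq by (rule sums_unique[OF single[of f, OF f0], symmetric])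
  have 2: "rank_one a e h = (complex_of_real (cmod a) * cinner h (v 0)) *\<^sub>C u 0"
    using single[of complex_of_real] is_svdD(6)[OF svd, of h] by (simp add: sums_unique2)
  show "sv_calculus f (rank_one a e) h = rank_one (f (cmod a) * sgn a) e h"
  proof (cases "a = 0")
    case True
    then show ?thesis using 1 f0 by (simp add: rank_one_def)
  next
    case False
    have "rank_one (f (cmod a) * sgn a) e h = (f (cmod a) / complex_of_real (cmod a)) *\<^sub>C rank_one a e h"
      by (simp add: rank_one_def scaleC_scaleC sgn_eq mult_ac)
    also have "\<dots> = (f (cmod a) * cinner h (v 0)) *\<^sub>C u 0"
      using False by (simp add: 2 scaleC_scaleC)
    finally show ?thesis using 1 by simp
  qed
qed

lemma rank_one_diff: "(\<lambda>h. rank_one a e h - rank_one b e h) = rank_one (a - b) e"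
  by (simp add: rank_one_def fun_eq_iff left_diff_distrib scaleC_diff_left)

lemma rank_one_inject: "rank_one a e = rank_one b e \<longleftrightarrow> a = b"
proof
  assume "rank_one a e = rank_one b e"
  then have "rank_one (a - b) e e = 0" by (metis eq_iff_diff_eq_0 rank_one_diff)
  then have "cmod (a - b) = 0"
    using e by (metis (no_types) rank_one_def cinner_self norm_scaleC norm_zero mult.right_neutral of_real_1 one_power2)
  then show "a = b" by simp
qed simp

end

section \<open>Comparison of the two seminorms\<close>

lemma Lip_C_norm_le_sv_Lip_norm:
  assumes nontrivial: "\<exists>x::'a::complex_hilbert_space. x \<noteq> 0" and f0: "f 0 = 0"
  shows "Lip_C_norm f \<le> sv_Lip_norm TYPE('a) f"
proof -
  obtain x0 :: 'a where "x0 \<noteq> 0" using nontrivial by blast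
  then have "norm (sgn x0) = 1" by (simp add: norm_sgn)
  then obtain e :: 'a where e: "norm e = 1" by blast
  show ?thesis
    unfolding Lip_C_norm_def
  proof (rule SUP_least, clarify)
    fix x y :: real and c
    assume xy: "0 \<le> x" "0 \<le> y" and c: "cmod c = 1" and ne: "complex_of_real x \<noteq> c * complex_of_real y"
    define A where "A = rank_one (complex_of_real x) e"
    define B where "B = rank_one (c * complex_of_real y) e"
    \<comment> \<open>At \<open>x = 0\<close> the phase \<open>sgn\<close> is 0 rather than 1, which
      does no harm because \<open>f 0 = 0\<close>.\<close>
    have "f x * sgn (complex_of_real x) = f x"
      using xy f0 by (cases "x = 0") (auto simp: sgn_eq)
    then have fA: "sv_calculus f A = rank_one (f x) e"
      using rank_one_sv_calculus[where f = f, OF e f0, of "complex_of_real x"] xy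
      by (simp only: A_def norm_of_real abs_of_nonneg)
    have "f y * sgn (c * complex_of_real y) = c * f y"
      using xy f0 c by (cases "y = 0") (auto simp: sgn_eq norm_mult)
    then have fB: "sv_calculus f B = rank_one (c * f y) e"
      using rank_one_sv_calculus[where f = f, OF e f0, of "c * complex_of_real y"] xy
      by (simp only: B_def norm_mult c norm_of_real abs_of_nonneg mult_1)
    have "ennreal (cmod (f x - c * f y) / cmod (complex_of_real x - c * complex_of_real y))
      = ennreal (hs_norm (\<lambda>h. sv_calculus f A h - sv_calculus f B h) / hs_norm (\<lambda>h. A h - B h))"
      unfolding fA fB unfolding A_def B_def rank_one_diff[OF e] rank_one_hs_norm[OF e] ..
    also have "\<dots> \<le> sv_Lip_norm TYPE('a) f"
    proof -
      have "(A, B) \<in> {(A, B). A \<in> hilbert_schmidt \<and> B \<in> hilbert_schmidt \<and> A \<noteq> B}"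
        using ne by (simp add: A_def B_def rank_one_hilbert_schmidt[OF e] rank_one_inject[OF e])
      then show ?thesis
        unfolding sv_Lip_norm_def by (rule SUP_upper2) simp
    qed
    finally show "ennreal (cmod (f x - c * f y) / cmod (complex_of_real x - c * complex_of_real y))
      \<le> sv_Lip_norm TYPE('a) f" .
  qed
qed

text \<open>The splitting \<open>(f x - f y) + (1 - c) * f y\<close> costs at most
  \<open>L * d\<close> and \<open>2 * L * d\<close>: the growth bound
  \<open>cmod (f y) \<le> L * y\<close> pairs with \<open>cmod (1 - c) * y \<le> 2 * d\<close>. The
  constant 3 is crude; the purpose is finiteness.\<close>

lemma Lip_C_norm_finite:
  assumes lip: "L-lipschitz_on {0..} f" and f0: "f 0 = 0"
  shows "Lip_C_norm f < top"
proof -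
  have L: "0 \<le> L" by (rule lipschitz_on_nonneg[OF lip])
  have "Lip_C_norm f \<le> ennreal (3 * L)"
    unfolding Lip_C_norm_def
  proof (rule SUP_least, clarify, rule ennreal_leI)
    fix x y :: real and c
    assume xy: "0 \<le> x" "0 \<le> y" and c: "cmod c = 1" and ne: "complex_of_real x \<noteq> c * complex_of_real y"
    define d where "d = cmod (complex_of_real x - c * complex_of_real y)"
    have d: "0 < d" using ne by (simp add: d_def)
    have 1: "\<bar>x - y\<bar> \<le> d"
      using norm_triangle_ineq3[of "complex_of_real x" "c * complex_of_real y"] xy c
      by (simp add: d_def norm_mult)
    have "cmod (complex_of_real y - c * complex_of_real y) \<le> cmod (complex_of_real (y - x)) + d"
      using norm_triangle_ineq[of "complex_of_real (y - x)" "complex_of_real x - c * complex_of_real y"]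
      by (simp add: d_def)
    then have 2: "cmod (complex_of_real y - c * complex_of_real y) \<le> 2 * d"
      using 1 unfolding norm_of_real by linarith
    have "cmod (f x - c * f y) = cmod ((f x - f y) + (1 - c) * f y)"
      by (simp add: algebra_simps)
    also have "\<dots> \<le> cmod (f x - f y) + cmod (1 - c) * cmod (f y)"
      using norm_triangle_ineq[of "f x - f y" "(1 - c) * f y"] by (simp add: norm_mult)
    also have "\<dots> \<le> L * \<bar>x - y\<bar> + cmod (1 - c) * (L * y)"
      using lipschitz_onD[OF lip, of x y] lipschitz_onD[OF lip, of y 0] xy f0
      by (intro add_mono mult_left_mono) (auto simp: dist_norm)
    also have "cmod (1 - c) * (L * y) = L * cmod (complex_of_real y - c * complex_of_real y)"
      using xy norm_mult[of "1 - c" "complex_of_real y"] by (simp add: algebra_simps)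
    also have "L * \<bar>x - y\<bar> + \<dots> \<le> L * d + L * (2 * d)"
      using 1 2 L by (intro add_mono mult_left_mono)
    finally have "cmod (f x - c * f y) \<le> 3 * L * d" by simp
    then show "cmod (f x - c * f y) / cmod (complex_of_real x - c * complex_of_real y) \<le> 3 * L"
      using d by (simp add: d_def divide_le_eq)
  qed
  then show ?thesis using ennreal_less_top le_less_trans by blast
qed

theorem theorem4p2:
  fixes f :: "real \<Rightarrow> complex"
    and A B :: "'a::complex_hilbert_space \<Rightarrow> 'a"
  assumes separable: "\<exists>D::'a set. countable D \<and> closure D = UNIV"
    and nontrivial: "\<exists>x::'a. x \<noteq> 0"
    and lipschitz: "\<exists>L. L-lipschitz_on {0..} f"
    and f_0: "f 0 = 0"
    and A: "A \<in> hilbert_schmidt"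
    and B: "B \<in> hilbert_schmidt"
  shows "sv_calculus f A \<in> hilbert_schmidt \<and> sv_calculus f B \<in> hilbert_schmidt \<and>
    ennreal (hs_norm (\<lambda>h. sv_calculus f A h - sv_calculus f B h))
      \<le> Lip_C_norm f * ennreal (hs_norm (\<lambda>h. A h - B h)) \<and>
    sv_Lip_norm TYPE('a) f = Lip_C_norm f"
proof -
  have "Lip_C_norm f < top" using lipschitz Lip_C_norm_finite f_0 by blast
  then obtain L where L: "0 \<le> L" "Lip_C_norm f = ennreal L"
    by (cases "Lip_C_norm f") auto
  have Lip: "\<forall>x\<ge>0. \<forall>y\<ge>0. \<forall>c. cmod c = 1 \<longrightarrow>
      cmod (f x - c * f y) \<le> L * cmod (complex_of_real x - c * complex_of_real y)"
  proof (intro allI impI)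
    fix x y :: real and c
    assume xy: "0 \<le> x" "0 \<le> y" and c: "cmod c = 1"
    show "cmod (f x - c * f y) \<le> L * cmod (complex_of_real x - c * complex_of_real y)"
    proof (cases "complex_of_real x = c * complex_of_real y")
      \<comment> \<open>These triples are excluded from the supremum. Comparing moduli gives
        \<open>x = y\<close>, and then either \<open>y = 0\<close> or \<open>c = 1\<close>, so the
        left-hand side is 0.\<close>
      case True
      then have "x = y"
        using xy c by (metis abs_of_nonneg mult_1 norm_mult norm_of_real)
      with True f_0 show ?thesis by (cases "y = 0") auto
    next
      case False
      then have "(x, y, c) \<in> {(x, y, c). 0 \<le> x \<and> 0 \<le> y \<and> cmod c = 1 \<and>
          complex_of_real x \<noteq> c * complex_of_real y}" using xy c by simp
      then have "ennreal (cmod (f x - c * f y) / cmod (complex_of_real x - c * complex_of_real y)) \<le> ennreal L"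
        unfolding L(2)[symmetric] Lip_C_norm_def by (rule SUP_upper2) simp
      then show ?thesis using L(1) False by (simp add: divide_le_eq)
    qed
  qed
  note main = sv_calculus_Lip_C[where f = f, OF _ _ f_0 L(1) Lip]
  have le: "ennreal (hs_norm (\<lambda>h. sv_calculus f A h - sv_calculus f B h))
      \<le> Lip_C_norm f * ennreal (hs_norm (\<lambda>h. A h - B h))"
    using main(3)[OF A B] L by (simp add: ennreal_leI flip: ennreal_mult')
  have "sv_Lip_norm TYPE('a) f \<le> Lip_C_norm f"
    unfolding sv_Lip_norm_def L(2)
  proof (rule SUP_least, clarify, rule ennreal_leI)
    fix A B :: "'a \<Rightarrow> 'a"
    assume AB: "A \<in> hilbert_schmidt" "B \<in> hilbert_schmidt" "A \<noteq> B"
    have hs: "(\<lambda>h. A h - B h) \<in> hilbert_schmidt" by (rule hilbert_schmidt_diff[OF AB(1,2)])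
    \<comment> \<open>Distinct operators have a difference of nonzero norm, so the operator estimate
      can be divided by it.\<close>
    have "hs_norm (\<lambda>h. A h - B h) \<noteq> 0"
      using hs_norm_eq_0_imp[OF hs] AB(3) by (metis eq_iff_diff_eq_0 ext)
    then have "0 < hs_norm (\<lambda>h. A h - B h)" using hs_norm_nonneg[OF hs] by linarith
    then show "hs_norm (\<lambda>h. sv_calculus f A h - sv_calculus f B h) / hs_norm (\<lambda>h. A h - B h) \<le> L"
      using main(3)[OF AB(1,2)] by (simp add: divide_le_eq)
  qed
  then show ?thesis
    using main(1)[OF A A] main(1)[OF B B] le Lip_C_norm_le_sv_Lip_norm[where f = f, OF nontrivial f_0]
    by (simp add: antisym)
qed

end
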